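(* Let $\mathcal Y$ be the graph defined in the context. Then $\mathcal Y$ is the union of a family of $102$ pairwise edge-disjoint subgraphs isomorphic to $K_4$, with every vertex of $\mathcal Y$ lying in exactly four of them. Moreover, $\mathcal Y$ is not the line graph of any simple graph, and $\mathcal Y$ is $K_4$-UH. Taking as points the $102$ vertices of $\mathcal Y$ and as lines the vertex sets of these $102$ copies of $K_4$ yields a self-dual $(102_4)$-configuration whose Menger graph is precisely $\mathcal Y$. In particular, $\mathcal Y$ is arc-transitive, regular of degree $12$, of diameter $3$, with distance distribution $(1,12,78,11)$. The Levi graph of this configuration is $2$-arc-transitive, regular of degree $4$, of diameter $6$, with distance distribution $(1,4,12,36,78,62,11)$.
   Context: The Biggs-Smith graph $\mathcal S$ is the cubic graph on the $102$ vertices $A_i,B_i,C_i,D_i,E_i,F_i$ ($i\in\mathbb Z_{17}$) whose edges are, for every $i\in\mathbb Z_{17}$: $A_iA_{i+1}$, $D_iD_{i+2}$, $C_iC_{i+4}$, $F_iF_{i+8}$, $A_iB_i$, $B_iC_i$, $D_iE_i$, $E_iF_i$, $B_iE_i$ (indices mod $17$). The graph $\mathcal Y$ has vertex set $V(\mathcal S)$, and two distinct vertices $u,v$ are adjacent in $\mathcal Y$ iff there is a $9$-cycle $(v_0,v_1,\dots,v_8)$ of $\mathcal S$ and an index $i$ with $\{u,v\}=\{v_i,v_{i+3}\}$ (indices mod $9$); i.e. $\mathcal Y$ is the union of the distance-$3$ graphs of the $9$-cycles of $\mathcal S$. A graph $G$ is $K_4$-UH if every isomorphism between two induced subgraphs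 of $G$ isomorphic to $K_4$ extends to an automorphism of $G$. An $(n_4)$-configuration consists of $n$ points and $n$ lines, each line a set of $4$ points, each point on exactly $4$ lines, any two points on at most one common line; it is self-dual if it is isomorphic to its dual (points and lines interchanged). Its Menger graph has the points as vertices, two points adjacent iff they lie on a common line; its Levi graph is the bipartite point-line incidence graph. The distance distribution $(d_0,d_1,\dots)$ of a vertex-transitive graph lists the number of vertices at distance $0,1,\dots$ from a fixed vertex. *)

theory Defs
  imports Main "HOL-Library.Extended_Nat"
begin

section \<open>Simple graphs\<close>

datatype 'a graph = Graph (verts: "'a set") (edges: "'a set set")

definition simple_graph :: "'a graph \<Rightarrow> bool" where
  "simple_graph G \<longleftrightarrow> (\<forall>e \<in> edges G. e \<subseteq> verts G \<and> card e = 2)"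

definition adjacent :: "'a graph \<Rightarrow> 'a \<Rightarrow> 'a \<Rightarrow> bool" where
  "adjacent G u v \<longleftrightarrow> {u, v} \<in> edges G"

definition is_subgraph :: "'a graph \<Rightarrow> 'a graph \<Rightarrow> bool" where
  "is_subgraph H G \<longleftrightarrow> simple_graph H \<and> verts H \<subseteq> verts G \<and> edges H \<subseteq> edges G"

definition induced :: "'a graph \<Rightarrow> 'a set \<Rightarrow> 'a graph" where
  "induced G W = Graph W {e \<in> edges G. e \<subseteq> W}"

definition graph_Union :: "'a graph set \<Rightarrow> 'a graph" where
  "graph_Union \<H> = Graph (\<Union>H\<in>\<H>. verts H) (\<Union>H\<in>\<H>. edges H)"

definition complete_graph :: "nat \<Rightarrow> nat graph" where
  "complete_graph n = Graph {..<n} {e. e \<subseteq> {..<n} \<and> card e = 2}"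

definition line_graph :: "'a graph \<Rightarrow> 'a set graph" where
  "line_graph G = Graph (edges G)
     {{e, f} | e f. e \<in> edges G \<and> f \<in> edges G \<and> e \<noteq> f \<and> e \<inter> f \<noteq> {}}"

definition graph_iso :: "('a \<Rightarrow> 'b) \<Rightarrow> 'a graph \<Rightarrow> 'b graph \<Rightarrow> bool" where
  "graph_iso f G H \<longleftrightarrow> bij_betw f (verts G) (verts H) \<and>
     (\<forall>u \<in> verts G. \<forall>v \<in> verts G. adjacent G u v \<longleftrightarrow> adjacent H (f u) (f v))"

definition graph_isomorphic :: "'a graph \<Rightarrow> 'b graph \<Rightarrow> bool" where
  "graph_isomorphic G H \<longleftrightarrow> (\<exists>f. graph_iso f G H)"

definition graph_aut :: "('a \<Rightarrow> 'a) \<Rightarrow> 'a graph \<Rightarrow> bool" where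
  "graph_aut g G \<longleftrightarrow> graph_iso g G G"

definition K4_UH :: "'a graph \<Rightarrow> bool" where
  "K4_UH G \<longleftrightarrow> (\<forall>W W' f. W \<subseteq> verts G \<longrightarrow> W' \<subseteq> verts G \<longrightarrow>
     graph_isomorphic (induced G W) (complete_graph 4) \<longrightarrow>
     graph_isomorphic (induced G W') (complete_graph 4) \<longrightarrow>
     graph_iso f (induced G W) (induced G W') \<longrightarrow>
     (\<exists>g. graph_aut g G \<and> (\<forall>v \<in> W. g v = f v)))"

definition regular_graph :: "nat \<Rightarrow> 'a graph \<Rightarrow> bool" where
  "regular_graph k G \<longleftrightarrow> (\<forall>v \<in> verts G. card {u \<in> verts G. adjacent G v u} = k)"

text \<open>An \<open>s\<close>-arc is given by the list of its \<open>s + 1\<close> vertices.\<close>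

definition s_arc :: "'a graph \<Rightarrow> nat \<Rightarrow> 'a list \<Rightarrow> bool" where
  "s_arc G s p \<longleftrightarrow> length p = s + 1 \<and> set p \<subseteq> verts G \<and>
     (\<forall>i < s. adjacent G (p ! i) (p ! (i + 1))) \<and>
     (\<forall>i. i + 2 \<le> s \<longrightarrow> p ! i \<noteq> p ! (i + 2))"

definition s_arc_transitive :: "nat \<Rightarrow> 'a graph \<Rightarrow> bool" where
  "s_arc_transitive s G \<longleftrightarrow>
     (\<forall>p q. s_arc G s p \<longrightarrow> s_arc G s q \<longrightarrow> (\<exists>g. graph_aut g G \<and> map g p = q))"

definition vertex_transitive :: "'a graph \<Rightarrow> bool" where
  "vertex_transitive G \<longleftrightarrow>
     (\<forall>u \<in> verts G. \<forall>v \<in> verts G. \<exists>g. graph_aut g G \<and> g u = v)"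

definition arc_transitive :: "'a graph \<Rightarrow> bool" where
  "arc_transitive G \<longleftrightarrow> s_arc_transitive 1 G"

definition walk :: "'a graph \<Rightarrow> 'a list \<Rightarrow> bool" where
  "walk G p \<longleftrightarrow> p \<noteq> [] \<and> set p \<subseteq> verts G \<and>
     (\<forall>i. i + 1 < length p \<longrightarrow> adjacent G (p ! i) (p ! (i + 1)))"

text \<open>The infimum over the empty set is \<open>\<infinity>\<close>, the distance between different components.\<close>

definition graph_dist :: "'a graph \<Rightarrow> 'a \<Rightarrow> 'a \<Rightarrow> enat" where
  "graph_dist G u v = (INF p \<in> {p. walk G p \<and> hd p = u \<and> last p = v}. enat (length p - 1))"

definition graph_diameter :: "'a graph \<Rightarrow> enat" where
  "graph_diameter G = (SUP u \<in> verts G. SUP v \<in> verts G. graph_dist G u v)"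

definition has_distance_distribution :: "'a graph \<Rightarrow> nat list \<Rightarrow> bool" where
  "has_distance_distribution G ds \<longleftrightarrow> vertex_transitive G \<and>
     (\<forall>v \<in> verts G. \<forall>k. card {u \<in> verts G. graph_dist G v u = enat k} =
        (if k < length ds then ds ! k else 0))"

definition graph_cycle :: "'a graph \<Rightarrow> 'a list \<Rightarrow> bool" where
  "graph_cycle G c \<longleftrightarrow> 3 \<le> length c \<and> distinct c \<and> set c \<subseteq> verts G \<and>
     (\<forall>i < length c. adjacent G (c ! i) (c ! ((i + 1) mod length c)))"


section \<open>Configurations\<close>

datatype 'a config = Config (points: "'a set") (lines: "'a set set")

definition n4_configuration :: "nat \<Rightarrow> 'a config \<Rightarrow> bool" where
  "n4_configuration n C \<longleftrightarrow>
     finite (points C) \<and> card (points C) = n \<and> finite (lines C) \<and> card (lines C) = n \<and>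
     (\<forall>l \<in> lines C. l \<subseteq> points C \<and> card l = 4) \<and>
     (\<forall>p \<in> points C. card {l \<in> lines C. p \<in> l} = 4) \<and>
     (\<forall>p \<in> points C. \<forall>q \<in> points C. p \<noteq> q \<longrightarrow> card {l \<in> lines C. p \<in> l \<and> q \<in> l} \<le> 1)"

definition config_iso :: "('a \<Rightarrow> 'b) \<Rightarrow> 'a config \<Rightarrow> 'b config \<Rightarrow> bool" where
  "config_iso f C D \<longleftrightarrow> bij_betw f (points C) (points D) \<and> (\<lambda>l. f ` l) ` lines C = lines D"

text \<open>
  A point becomes the line of the dual that consists of the original lines through it. In an
  \<open>(n\<^sub>4)\<close>-configuration distinct points lie on distinct sets of lines, so no two points
  are identified in the dual.
\<close>

definition dual_config :: "'a config \<Rightarrow> 'a set config" where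
  "dual_config C = Config (lines C) ((\<lambda>p. {l \<in> lines C. p \<in> l}) ` points C)"

definition self_dual :: "'a config \<Rightarrow> bool" where
  "self_dual C \<longleftrightarrow> (\<exists>f. config_iso f C (dual_config C))"

definition menger_graph :: "'a config \<Rightarrow> 'a graph" where
  "menger_graph C = Graph (points C)
     {{p, q} | p q. p \<in> points C \<and> q \<in> points C \<and> p \<noteq> q \<and> (\<exists>l \<in> lines C. p \<in> l \<and> q \<in> l)}"

definition levi_graph :: "'a config \<Rightarrow> ('a + 'a set) graph" where
  "levi_graph C = Graph (points C <+> lines C)
     {{Inl p, Inr l} | p l. p \<in> points C \<and> l \<in> lines C \<and> p \<in> l}"


section \<open>The Biggs-Smith graph and the graph of its 9-cycles\<close>

text \<open>Indices in \<open>\<int>\<^sub>1\<^sub>7\<close> are represented by the naturals below 17.\<close>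

datatype bs_vertex = A\<^sub>v nat | B\<^sub>v nat | C\<^sub>v nat | D\<^sub>v nat | E\<^sub>v nat | F\<^sub>v nat

definition biggs_smith :: "bs_vertex graph" where
  "biggs_smith = Graph
     (\<Union>i \<in> {..<17}. {A\<^sub>v i, B\<^sub>v i, C\<^sub>v i, D\<^sub>v i, E\<^sub>v i, F\<^sub>v i})
     (\<Union>i \<in> {..<17}.
        {{A\<^sub>v i, A\<^sub>v ((i + 1) mod 17)}, {D\<^sub>v i, D\<^sub>v ((i + 2) mod 17)},
         {C\<^sub>v i, C\<^sub>v ((i + 4) mod 17)}, {F\<^sub>v i, F\<^sub>v ((i + 8) mod 17)},
         {A\<^sub>v i, B\<^sub>v i}, {B\<^sub>v i, C\<^sub>v i}, {D\<^sub>v i, E\<^sub>v i}, {E\<^sub>v i, F\<^sub>v i}, {B\<^sub>v i, E\<^sub>v i}})"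

definition \<Y> :: "bs_vertex graph" where
  "\<Y> = Graph (verts biggs_smith)
     {{u, v} | u v. u \<in> verts biggs_smith \<and> v \<in> verts biggs_smith \<and> u \<noteq> v \<and>
        (\<exists>c i. graph_cycle biggs_smith c \<and> length c = 9 \<and> i < 9 \<and>
               {u, v} = {c ! i, c ! ((i + 3) mod 9)})}"

end

theory Submission
  imports Defs
begin

text \<open>
  The configuration is the coset geometry of \<open>PSL(2,17)\<close>, the automorphism group of the
  Biggs-Smith graph, with respect to its two classes of subgroups \<open>S\<^sub>4\<close>, which
  \<open>PGL(2,17)\<close> interchanges. Three generators act on points and lines: the rotation of the
  indices, the map \<open>\<mu>\<close> that doubles the indices and permutes the six letters, and one
  involution \<open>\<tau>\<close>. The group is transitive on lines, and \<open>\<mu>\<^sup>2\<close> and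
  \<open>\<tau>\<close> fix a base line and act on its four points as a 4-cycle and a transposition
  of neighbours, so the group is transitive on the \<open>102 \<cdot> 24\<close> ordered lines. Hence every
  property of a pair of collinear points or of an ordered line needs checking in one place only.
  Every path of length 3 of the Biggs-Smith graph lies in a 9-cycle, so vertices are adjacent in
  \<open>\<Y>\<close> iff they are joined by such a path, and this holds iff they are collinear.
  Multiplication of the indices by 6, a square root of 2 modulo 17, induces a duality whose square
  is \<open>\<mu>\<close>; together with the group it yields the transitivity of the Levi graph, whose
  distances from one point determine those of \<open>\<Y>\<close>.
\<close>

section \<open>Graphs and their automorphisms\<close>

lemma adjacent_commute: "adjacent G u v \<longleftrightarrow> adjacent G v u"
  by (simp add: adjacent_def insert_commute)

lemma graph_aut_bij: "graph_aut g G \<Longrightarrow> bij_betw g (verts G) (verts G)"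
  by (simp add: graph_aut_def graph_iso_def)

lemma graph_aut_in_verts: "graph_aut g G \<Longrightarrow> v \<in> verts G \<Longrightarrow> g v \<in> verts G"
  using bij_betwE graph_aut_bij by blast

lemma graph_aut_adjacent:
  "graph_aut g G \<Longrightarrow> u \<in> verts G \<Longrightarrow> v \<in> verts G \<Longrightarrow> adjacent G (g u) (g v) \<longleftrightarrow> adjacent G u v"
  by (simp add: graph_aut_def graph_iso_def)

lemma graph_aut_eq_iff:
  "graph_aut g G \<Longrightarrow> u \<in> verts G \<Longrightarrow> v \<in> verts G \<Longrightarrow> g u = g v \<longleftrightarrow> u = v"
  by (meson bij_betw_def graph_aut_bij inj_on_eq_iff)

lemma graph_aut_comp: "graph_aut g G \<Longrightarrow> graph_aut h G \<Longrightarrow> graph_aut (h \<circ> g) G"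
  unfolding graph_aut_def graph_iso_def
  by (auto intro: bij_betw_trans dest: bij_betwE)

lemma graph_aut_inv:
  assumes "graph_aut g G"
  shows "graph_aut (inv_into (verts G) g) G"
proof -
  have g: "bij_betw g (verts G) (verts G)" by (rule graph_aut_bij[OF assms])
  have "bij_betw (inv_into (verts G) g) (verts G) (verts G)"
    by (rule bij_betw_inv_into[OF g])
  moreover have "adjacent G u v \<longleftrightarrow> adjacent G (inv_into (verts G) g u) (inv_into (verts G) g v)"
    if "u \<in> verts G" "v \<in> verts G" for u v
    using that g graph_aut_adjacent[OF assms, of "inv_into (verts G) g u" "inv_into (verts G) g v"]
    by (metis bij_betw_inv_into_right bij_betw_imp_surj_on inv_into_into)
  ultimately show ?thesis by (simp add: graph_aut_def graph_iso_def)
qed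

lemma graph_aut_inv_map:
  assumes "graph_aut g G" "set p \<subseteq> verts G"
  shows "map (inv_into (verts G) g) (map g p) = p"
  using assms(2) bij_betw_inv_into_left[OF graph_aut_bij[OF assms(1)]] by (induction p) auto

text \<open>Only one base vertex has to be moved everywhere: to take \<open>u\<close> to
  \<open>v\<close>, go back to \<open>s\<close> by an inverse and out again.\<close>

lemma vertex_transitiveI:
  assumes "s \<in> verts G" and orbit: "\<And>v. v \<in> verts G \<Longrightarrow> \<exists>g. graph_aut g G \<and> g s = v"
  shows "vertex_transitive G"
  unfolding vertex_transitive_def
proof (intro ballI)
  fix u v assume "u \<in> verts G" "v \<in> verts G"
  then obtain g h where "graph_aut g G" "g s = u" "graph_aut h G" "h s = v"
    using orbit by metis
  then have "graph_aut (h \<circ> inv_into (verts G) g) G" "(h \<circ> inv_into (verts G) g) u = v"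
    using graph_aut_comp[OF graph_aut_inv] bij_betw_inv_into_left[OF graph_aut_bij assms(1)]
    by auto
  then show "\<exists>g. graph_aut g G \<and> g u = v" by blast
qed

lemma s_arc_map:
  assumes g: "graph_aut g G" and p: "s_arc G s p"
  shows "s_arc G s (map g p)"
proof -
  have "p ! i \<in> verts G" if "i \<le> s" for i
    using p that by (auto simp: s_arc_def)
  with p show ?thesis
    by (auto simp: s_arc_def graph_aut_adjacent[OF g] graph_aut_eq_iff[OF g] graph_aut_in_verts[OF g])
qed

text \<open>The same reduction for arcs, with the list \<open>b\<close> as the common origin of all
  of them.\<close>

lemma s_arc_transitiveI:
  assumes b: "set b \<subseteq> verts G"
    and orbit: "\<And>p. s_arc G s p \<Longrightarrow> \<exists>g. graph_aut g G \<and> map g b = p"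
  shows "s_arc_transitive s G"
  unfolding s_arc_transitive_def
proof (intro allI impI)
  fix p q assume "s_arc G s p" "s_arc G s q"
  then obtain g h where gh: "graph_aut g G" "map g b = p" "graph_aut h G" "map h b = q"
    using orbit by metis
  have "map (h \<circ> inv_into (verts G) g) p = q"
    using graph_aut_inv_map[OF gh(1) b] gh(2,4) by (metis map_map)
  then show "\<exists>g. graph_aut g G \<and> map g p = q"
    using graph_aut_comp[OF graph_aut_inv[OF gh(1)] gh(3)] by blast
qed

lemma graph_cycle_map:
  assumes g: "graph_aut g G" and c: "graph_cycle G c"
  shows "graph_cycle G (map g c)"
proof -
  have verts: "set c \<subseteq> verts G" using c by (simp add: graph_cycle_def)
  have "inj_on g (set c)"
    using verts graph_aut_bij[OF g] by (meson bij_betw_def inj_on_subset)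
  moreover have "adjacent G (map g c ! i) (map g c ! ((i + 1) mod length c))" if "i < length c" for i
  proof -
    have "(i + 1) mod length c < length c" using that by (intro mod_less_divisor) auto
    then show ?thesis
      using c that verts by (auto simp: graph_cycle_def graph_aut_adjacent[OF g] subset_iff)
  qed
  ultimately show ?thesis
    using c graph_aut_in_verts[OF g] by (auto simp: graph_cycle_def distinct_map)
qed

section \<open>Walks and distances\<close>

lemma walk_map:
  assumes g: "graph_aut g G" and p: "walk G p"
  shows "walk G (map g p)"
proof -
  have "p ! i \<in> verts G" if "i < length p" for i
    using p that by (auto simp: walk_def)
  with p show ?thesis
    by (auto simp: walk_def graph_aut_adjacent[OF g] graph_aut_in_verts[OF g])
qed

lemma graph_dist_le: "walk G p \<Longrightarrow> graph_dist G (hd p) (last p) \<le> enat (length p - 1)"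
  unfolding graph_dist_def by (rule INF_lower) simp

lemma graph_dist_map_le:
  assumes g: "graph_aut g G"
  shows "graph_dist G (g u) (g v) \<le> graph_dist G u v"
  unfolding graph_dist_def[of G u v]
proof (rule INF_greatest)
  fix p assume "p \<in> {p. walk G p \<and> hd p = u \<and> last p = v}"
  then have "walk G p" "hd p = u" "last p = v" by auto
  then show "graph_dist G (g u) (g v) \<le> enat (length p - 1)"
    using graph_dist_le[OF walk_map[OF g], of p] by (auto simp: walk_def hd_map last_map)
qed

lemma graph_dist_map:
  assumes g: "graph_aut g G" and "u \<in> verts G" "v \<in> verts G"
  shows "graph_dist G (g u) (g v) = graph_dist G u v"
proof (rule antisym[OF graph_dist_map_le[OF g]])
  show "graph_dist G u v \<le> graph_dist G (g u) (g v)"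
    using graph_dist_map_le[OF graph_aut_inv[OF g], of "g u" "g v"] assms(2,3)
    by (simp add: bij_betw_inv_into_left[OF graph_aut_bij[OF g]])
qed

lemma walk_snoc:
  assumes "walk G p" "adjacent G (last p) v" "v \<in> verts G"
  shows "walk G (p @ [v])"
  unfolding walk_def
proof (intro conjI allI impI)
  fix i assume "i + 1 < length (p @ [v])"
  then consider "i + 1 < length p" | "i + 1 = length p" by force
  then show "adjacent G ((p @ [v]) ! i) ((p @ [v]) ! (i + 1))"
  proof cases
    case 1
    then show ?thesis using assms(1) by (simp add: walk_def nth_append)
  next
    case 2
    then have "p ! i = last p" using assms(1) by (simp add: walk_def last_conv_nth flip: 2)
    with 2 show ?thesis using assms(2) by (simp add: nth_append)
  qed
qed (use assms in \<open>auto simp: walk_def\<close>)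

text \<open>A certificate for the distances from \<open>s\<close>. By \<open>step\<close> no walk
  from \<open>s\<close> climbs by more than one level per edge, so \<open>d v\<close> is a lower
  bound. By \<open>pred\<close> and \<open>unique_source\<close> one can descend from
  \<open>v\<close> to \<open>s\<close> in exactly \<open>d v\<close> edges.\<close>

locale distance_levels =
  fixes G :: "'a graph" and s :: 'a and d :: "'a \<Rightarrow> nat"
  assumes source: "s \<in> verts G" "d s = 0"
    and unique_source: "\<And>v. v \<in> verts G \<Longrightarrow> d v = 0 \<Longrightarrow> v = s"
    and step: "\<And>u v. u \<in> verts G \<Longrightarrow> v \<in> verts G \<Longrightarrow> adjacent G u v \<Longrightarrow> d v \<le> Suc (d u)"
    and pred: "\<And>v. v \<in> verts G \<Longrightarrow> d v \<noteq> 0 \<Longrightarrow> \<exists>u\<in>verts G. adjacent G u v \<and> d v = Suc (d u)"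
begin

lemma d_le_index:
  assumes "walk G p" "hd p = s"
  shows "i < length p \<Longrightarrow> d (p ! i) \<le> i"
proof (induction i)
  case 0
  then show ?case using assms source by (simp add: walk_def hd_conv_nth)
next
  case (Suc i)
  then have "d (p ! Suc i) \<le> Suc (d (p ! i))"
    using assms by (intro step) (auto simp: walk_def)
  with Suc show ?case by simp
qed

lemma shortest_walk:
  "v \<in> verts G \<Longrightarrow> \<exists>p. walk G p \<and> hd p = s \<and> last p = v \<and> length p = Suc (d v)"
proof (induction "d v" arbitrary: v)
  case 0
  then have "v = s" using unique_source by simp
  then show ?case using source by (intro exI[of _ "[s]"]) (simp add: walk_def)
next
  case (Suc n)
  then obtain u where u: "u \<in> verts G" "adjacent G u v" "d v = Suc (d u)"
    using pred by (metis nat.distinct(1))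
  with Suc(1)[of u] Suc(2) obtain p where p: "walk G p" "hd p = s" "last p = u" "length p = Suc (d u)"
    by auto
  then have "hd (p @ [v]) = s" by (cases p) auto
  with p u Suc(3) show ?case
    by (intro exI[of _ "p @ [v]"]) (simp add: walk_snoc)
qed

lemma graph_dist_eq:
  assumes "v \<in> verts G"
  shows "graph_dist G s v = enat (d v)"
proof (rule antisym)
  show "graph_dist G s v \<le> enat (d v)"
    using shortest_walk[OF assms] graph_dist_le by (metis diff_Suc_1)
  show "enat (d v) \<le> graph_dist G s v"
    unfolding graph_dist_def
  proof (rule INF_greatest)
    fix p assume "p \<in> {p. walk G p \<and> hd p = s \<and> last p = v}"
    then have p: "walk G p" "hd p = s" "last p = v" by auto
    then have "p \<noteq> []" by (simp add: walk_def)
    with d_le_index[OF p(1,2), of "length p - 1"] p(3) show "enat (d v) \<le> enat (length p - 1)"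
      by (simp add: last_conv_nth)
  qed
qed

text \<open>An automorphism taking \<open>s\<close> to \<open>v\<close> carries the level sets of
  \<open>d\<close> onto the spheres around \<open>v\<close>, so counting around \<open>s\<close> is
  enough.\<close>

lemma card_at_distance:
  assumes "vertex_transitive G" "v \<in> verts G"
  shows "card {u \<in> verts G. graph_dist G v u = enat k} = card {u \<in> verts G. d u = k}"
proof -
  obtain g where g: "graph_aut g G" "g s = v"
    using assms source by (meson vertex_transitive_def)
  have "{u \<in> verts G. graph_dist G v u = enat k} = g ` {u \<in> verts G. d u = k}"
    using graph_dist_map[OF g(1) source(1)] graph_dist_eq g(2) graph_aut_in_verts[OF g(1)]
      bij_betw_imp_surj_on[OF graph_aut_bij[OF g(1)]]
    by (auto simp: image_iff) (metis (no_types, lifting) enat.inject image_iff)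
  moreover have "inj_on g {u \<in> verts G. d u = k}"
    using graph_aut_bij[OF g(1)] by (auto simp: bij_betw_def inj_on_def)
  ultimately show ?thesis by (simp add: card_image)
qed

text \<open>Any pair of vertices can be moved to a pair that starts at \<open>s\<close>, where the
  distance is a value of \<open>d\<close>.\<close>

lemma diameter_eq:
  assumes vt: "vertex_transitive G" and le: "\<And>v. v \<in> verts G \<Longrightarrow> d v \<le> m"
    and attained: "w \<in> verts G" "d w = m"
  shows "graph_diameter G = enat m"
proof (rule antisym)
  show "graph_diameter G \<le> enat m"
    unfolding graph_diameter_def
  proof (intro SUP_least)
    fix u v assume uv: "u \<in> verts G" "v \<in> verts G"
    then obtain g where g: "graph_aut g G" "g u = s"
      using vt source by (meson vertex_transitive_def)
    then have "graph_dist G u v = enat (d (g v))"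
      using graph_dist_map[OF g(1) uv] graph_dist_eq graph_aut_in_verts uv by metis
    with le[OF graph_aut_in_verts[OF g(1) uv(2)]] show "graph_dist G u v \<le> enat m" by simp
  qed
  show "enat m \<le> graph_diameter G"
    unfolding graph_diameter_def graph_dist_eq[OF attained(1), unfolded attained(2), symmetric]
    by (rule SUP_upper2[OF source(1)], rule SUP_upper[OF attained(1)])
qed

end

section \<open>Criteria for line graphs and complete subgraphs\<close>

lemma line_graph_claw_free:
  assumes H: "simple_graph H" and f: "graph_iso f G (line_graph H)"
    and verts: "{p, q, r, s} \<subseteq> verts G" and "distinct [q, r, s]"
    and adj: "adjacent G p q" "adjacent G p r" "adjacent G p s"
  shows "adjacent G q r \<or> adjacent G q s \<or> adjacent G r s"
proof -
  have meet: "adjacent G u v \<longleftrightarrow> f u \<noteq> f v \<and> f u \<inter> f v \<noteq> {}" if "u \<in> verts G" "v \<in> verts G" for u v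
  proof -
    have "f u \<in> edges H" "f v \<in> edges H"
      using f that by (auto simp: graph_iso_def line_graph_def dest: bij_betwE)
    moreover have "adjacent G u v \<longleftrightarrow> {f u, f v} \<in> edges (line_graph H)"
      using f that by (simp add: graph_iso_def adjacent_def)
    ultimately show ?thesis
      by (auto simp: line_graph_def doubleton_eq_iff)
  qed
  have "f p \<in> edges H"
    using f verts by (auto simp: graph_iso_def line_graph_def dest: bij_betwE)
  with H have "card (f p) = 2" by (simp add: simple_graph_def)
  then obtain x y where "f p = {x, y}" by (meson card_2_iff)
  moreover have "f p \<inter> f q \<noteq> {}" "f p \<inter> f r \<noteq> {}" "f p \<inter> f s \<noteq> {}"
    using adj verts by (auto simp: meet)
  \<comment> \<open>Pigeonhole: three edges meet the edge \<open>{x, y}\<close>, so two of them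
    share one of its two ends.\<close>
  ultimately have "f q \<inter> f r \<noteq> {} \<or> f q \<inter> f s \<noteq> {} \<or> f r \<inter> f s \<noteq> {}" by auto
  moreover have "f q \<noteq> f r" "f q \<noteq> f s" "f r \<noteq> f s"
    using f verts \<open>distinct [q, r, s]\<close> by (auto simp: graph_iso_def bij_betw_def inj_on_eq_iff)
  ultimately show ?thesis using verts by (auto simp: meet)
qed

lemma graph_isomorphic_completeI:
  assumes "finite (verts G)" "card (verts G) = n"
    and adj: "\<And>u v. u \<in> verts G \<Longrightarrow> v \<in> verts G \<Longrightarrow> adjacent G u v \<longleftrightarrow> u \<noteq> v"
  shows "graph_isomorphic G (complete_graph n)"
proof -
  obtain f where f: "bij_betw f (verts G) {..<n}"
    using assms(1,2) ex_bij_betw_finite_nat atLeast0LessThan by metis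
  then have "adjacent (complete_graph n) (f u) (f v) \<longleftrightarrow> u \<noteq> v" if "u \<in> verts G" "v \<in> verts G" for u v
    using that by (auto simp: adjacent_def complete_graph_def card_2_iff' bij_betw_def inj_on_eq_iff)
  with f show ?thesis
    unfolding graph_isomorphic_def graph_iso_def by (auto simp: adj complete_graph_def)
qed

lemma induced_completeD:
  assumes "graph_isomorphic (induced G W) (complete_graph n)"
  shows "card W = n" and "u \<in> W \<Longrightarrow> v \<in> W \<Longrightarrow> u \<noteq> v \<Longrightarrow> adjacent G u v"
proof -
  obtain f where f: "bij_betw f W {..<n}"
    "\<And>u v. u \<in> W \<Longrightarrow> v \<in> W \<Longrightarrow> adjacent (induced G W) u v \<longleftrightarrow> adjacent (complete_graph n) (f u) (f v)"
    using assms by (auto simp: graph_isomorphic_def graph_iso_def induced_def complete_graph_def)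
  show "card W = n" using bij_betw_same_card[OF f(1)] by simp
  assume uv: "u \<in> W" "v \<in> W" "u \<noteq> v"
  then have "adjacent (complete_graph n) (f u) (f v)"
    using f(1) by (auto simp: adjacent_def complete_graph_def bij_betw_def inj_on_eq_iff)
  then show "adjacent G u v"
    using f(2)[OF uv(1,2)] by (auto simp: adjacent_def induced_def)
qed

section \<open>Coordinates for points and lines\<close>

abbreviation V :: "bs_vertex set" where
  "V \<equiv> verts biggs_smith"

lemma V_eq: "V = (\<Union>i<17. {A\<^sub>v i, B\<^sub>v i, C\<^sub>v i, D\<^sub>v i, E\<^sub>v i, F\<^sub>v i})"
  by (simp add: biggs_smith_def)

lemma V_iff [simp]:
  "A\<^sub>v i \<in> V \<longleftrightarrow> i < 17" "B\<^sub>v i \<in> V \<longleftrightarrow> i < 17" "C\<^sub>v i \<in> V \<longleftrightarrow> i < 17"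
  "D\<^sub>v i \<in> V \<longleftrightarrow> i < 17" "E\<^sub>v i \<in> V \<longleftrightarrow> i < 17" "F\<^sub>v i \<in> V \<longleftrightarrow> i < 17"
  by (auto simp: V_eq)

lemma Ball_less_17:
  "(\<forall>i<17. P i) \<longleftrightarrow> P 0 \<and> P 1 \<and> P 2 \<and> P 3 \<and> P 4 \<and> P 5 \<and> P 6 \<and> P 7 \<and> P 8 \<and> P 9 \<and>
     P 10 \<and> P 11 \<and> P 12 \<and> P 13 \<and> P 14 \<and> P 15 \<and> P (16::nat)"
  by (simp add: numeral_eq_Suc All_less_Suc conj_ac)

lemma Ball_V:
  "(\<forall>v\<in>V. P v) \<longleftrightarrow> (\<forall>i<17. P (A\<^sub>v i)) \<and> (\<forall>i<17. P (B\<^sub>v i)) \<and> (\<forall>i<17. P (C\<^sub>v i)) \<and>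
     (\<forall>i<17. P (D\<^sub>v i)) \<and> (\<forall>i<17. P (E\<^sub>v i)) \<and> (\<forall>i<17. P (F\<^sub>v i))"
  by (auto simp: V_eq)

text \<open>Unfolding these turns a statement about all 102 vertices into a conjunction of ground
  instances that simplification evaluates.\<close>

lemmas check_V = Ball_V Ball_less_17

text \<open>Backward steps are written as additions of the complement to 17 (\<open>i + 13\<close>
  for \<open>i - 4\<close>), since subtraction of naturals truncates at zero. The tables of lines
  below follow the same convention.\<close>

fun nbs :: "bs_vertex \<Rightarrow> bs_vertex list" where
  "nbs (A\<^sub>v i) = [A\<^sub>v ((i + 1) mod 17), A\<^sub>v ((i + 16) mod 17), B\<^sub>v i]" |
  "nbs (B\<^sub>v i) = [A\<^sub>v i, C\<^sub>v i, E\<^sub>v i]" |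
  "nbs (C\<^sub>v i) = [C\<^sub>v ((i + 4) mod 17), C\<^sub>v ((i + 13) mod 17), B\<^sub>v i]" |
  "nbs (D\<^sub>v i) = [D\<^sub>v ((i + 2) mod 17), D\<^sub>v ((i + 15) mod 17), E\<^sub>v i]" |
  "nbs (E\<^sub>v i) = [D\<^sub>v i, F\<^sub>v i, B\<^sub>v i]" |
  "nbs (F\<^sub>v i) = [F\<^sub>v ((i + 8) mod 17), F\<^sub>v ((i + 9) mod 17), E\<^sub>v i]"

text \<open>
  Lines are labelled by vertices too, so that rotating the indices of the points of a line rotates
  the index of its label; the letters are chosen such that the correlation
  \<open>X\<^sub>i \<mapsto> X\<^sub>6\<^sub>i\<close> from points to lines is a duality. The order of the points on
  \<open>B\<^sub>0\<close> is the cyclic order under \<open>\<mu>\<^sup>2\<close>.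
\<close>

fun line_pts :: "bs_vertex \<Rightarrow> bs_vertex list" where
  "line_pts (A\<^sub>v j) = [B\<^sub>v ((j + 8) mod 17), B\<^sub>v ((j + 9) mod 17), C\<^sub>v j, F\<^sub>v j]" |
  "line_pts (B\<^sub>v j) =
     [D\<^sub>v ((j + 3) mod 17), F\<^sub>v ((j + 12) mod 17), D\<^sub>v ((j + 14) mod 17), F\<^sub>v ((j + 5) mod 17)]" |
  "line_pts (C\<^sub>v j) = [A\<^sub>v j, B\<^sub>v ((j + 2) mod 17), B\<^sub>v ((j + 15) mod 17), D\<^sub>v j]" |
  "line_pts (D\<^sub>v j) = [A\<^sub>v j, E\<^sub>v ((j + 1) mod 17), E\<^sub>v ((j + 16) mod 17), F\<^sub>v j]" |
  "line_pts (E\<^sub>v j) =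
     [A\<^sub>v ((j + 7) mod 17), A\<^sub>v ((j + 10) mod 17), C\<^sub>v ((j + 6) mod 17), C\<^sub>v ((j + 11) mod 17)]" |
  "line_pts (F\<^sub>v j) = [C\<^sub>v j, D\<^sub>v j, E\<^sub>v ((j + 4) mod 17), E\<^sub>v ((j + 13) mod 17)]"

text \<open>The inverse incidence table, spelled out so that a question about the lines through a
  given point becomes a search through four labels.\<close>

fun pt_lines :: "bs_vertex \<Rightarrow> bs_vertex list" where
  "pt_lines (A\<^sub>v i) = [C\<^sub>v i, D\<^sub>v i, E\<^sub>v ((i + 7) mod 17), E\<^sub>v ((i + 10) mod 17)]" |
  "pt_lines (B\<^sub>v i) =
     [A\<^sub>v ((i + 8) mod 17), A\<^sub>v ((i + 9) mod 17), C\<^sub>v ((i + 2) mod 17), C\<^sub>v ((i + 15) mod 17)]" |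
  "pt_lines (C\<^sub>v i) = [A\<^sub>v i, E\<^sub>v ((i + 6) mod 17), E\<^sub>v ((i + 11) mod 17), F\<^sub>v i]" |
  "pt_lines (D\<^sub>v i) = [B\<^sub>v ((i + 3) mod 17), B\<^sub>v ((i + 14) mod 17), C\<^sub>v i, F\<^sub>v i]" |
  "pt_lines (E\<^sub>v i) =
     [D\<^sub>v ((i + 1) mod 17), D\<^sub>v ((i + 16) mod 17), F\<^sub>v ((i + 4) mod 17), F\<^sub>v ((i + 13) mod 17)]" |
  "pt_lines (F\<^sub>v i) = [A\<^sub>v i, B\<^sub>v ((i + 5) mod 17), B\<^sub>v ((i + 12) mod 17), D\<^sub>v i]"

fun affine :: "nat \<Rightarrow> nat \<Rightarrow> bs_vertex \<Rightarrow> bs_vertex" where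
  "affine m b (A\<^sub>v i) = A\<^sub>v ((m * i + b) mod 17)" |
  "affine m b (B\<^sub>v i) = B\<^sub>v ((m * i + b) mod 17)" |
  "affine m b (C\<^sub>v i) = C\<^sub>v ((m * i + b) mod 17)" |
  "affine m b (D\<^sub>v i) = D\<^sub>v ((m * i + b) mod 17)" |
  "affine m b (E\<^sub>v i) = E\<^sub>v ((m * i + b) mod 17)" |
  "affine m b (F\<^sub>v i) = F\<^sub>v ((m * i + b) mod 17)"

text \<open>Doubling the indices turns the step lengths 1, 2, 4, 8 of \<open>A\<^sub>v\<close>,
  \<open>D\<^sub>v\<close>, \<open>C\<^sub>v\<close>, \<open>F\<^sub>v\<close> into 2, 4, 8 and -1
  modulo 17, so these letters have to be cycled in this order. Exchanging \<open>B\<^sub>v\<close>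
  and \<open>E\<^sub>v\<close> then preserves the remaining edges.\<close>

fun turn :: "bs_vertex \<Rightarrow> bs_vertex" where
  "turn (A\<^sub>v i) = D\<^sub>v i" |
  "turn (D\<^sub>v i) = C\<^sub>v i" |
  "turn (C\<^sub>v i) = F\<^sub>v i" |
  "turn (F\<^sub>v i) = A\<^sub>v i" |
  "turn (B\<^sub>v i) = E\<^sub>v i" |
  "turn (E\<^sub>v i) = B\<^sub>v i"

text \<open>
  The automorphism of the Biggs-Smith graph that swaps the points \<open>D\<^sub>3\<close> and
  \<open>F\<^sub>1\<^sub>2\<close> of the line \<open>B\<^sub>0\<close> and fixes its other two points, and its
  action on lines.
\<close>

fun tau_pt :: "bs_vertex \<Rightarrow> bs_vertex" where
  "tau_pt (A\<^sub>v i) =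
     [A\<^sub>v 10, A\<^sub>v 11, B\<^sub>v 11, E\<^sub>v 11, D\<^sub>v 11, D\<^sub>v 13, D\<^sub>v 15, D\<^sub>v 0, E\<^sub>v 0, B\<^sub>v 0, A\<^sub>v 0,
      A\<^sub>v 1, B\<^sub>v 1, C\<^sub>v 1, C\<^sub>v 14, C\<^sub>v 10, B\<^sub>v 10] ! i" |
  "tau_pt (B\<^sub>v i) =
     [A\<^sub>v 9, A\<^sub>v 12, C\<^sub>v 11, F\<^sub>v 11, D\<^sub>v 9, E\<^sub>v 13, E\<^sub>v 15, D\<^sub>v 2, F\<^sub>v 0, C\<^sub>v 0, A\<^sub>v 16,
      A\<^sub>v 2, E\<^sub>v 1, C\<^sub>v 5, B\<^sub>v 14, C\<^sub>v 6, E\<^sub>v 10] ! i" |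
  "tau_pt (C\<^sub>v i) =
     [B\<^sub>v 9, A\<^sub>v 13, C\<^sub>v 15, F\<^sub>v 2, E\<^sub>v 9, B\<^sub>v 13, B\<^sub>v 15, E\<^sub>v 2, F\<^sub>v 9, C\<^sub>v 13, A\<^sub>v 15,
      B\<^sub>v 2, F\<^sub>v 1, C\<^sub>v 9, A\<^sub>v 14, C\<^sub>v 2, F\<^sub>v 10] ! i" |
  "tau_pt (D\<^sub>v i) =
     [A\<^sub>v 7, E\<^sub>v 12, B\<^sub>v 7, F\<^sub>v 12, E\<^sub>v 7, F\<^sub>v 4, F\<^sub>v 7, E\<^sub>v 4, F\<^sub>v 16, B\<^sub>v 4, E\<^sub>v 16,
      A\<^sub>v 4, D\<^sub>v 16, A\<^sub>v 5, D\<^sub>v 14, A\<^sub>v 6, D\<^sub>v 12] ! i" |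
  "tau_pt (E\<^sub>v i) =
     [A\<^sub>v 8, B\<^sub>v 12, C\<^sub>v 7, F\<^sub>v 3, D\<^sub>v 7, F\<^sub>v 13, F\<^sub>v 15, D\<^sub>v 4, F\<^sub>v 8, C\<^sub>v 4, B\<^sub>v 16,
      A\<^sub>v 3, D\<^sub>v 1, B\<^sub>v 5, E\<^sub>v 14, B\<^sub>v 6, D\<^sub>v 10] ! i" |
  "tau_pt (F\<^sub>v i) =
     [B\<^sub>v 8, C\<^sub>v 12, C\<^sub>v 3, E\<^sub>v 3, D\<^sub>v 5, F\<^sub>v 5, F\<^sub>v 6, D\<^sub>v 6, E\<^sub>v 8, C\<^sub>v 8, C\<^sub>v 16, B\<^sub>v 3,
      D\<^sub>v 3, E\<^sub>v 5, F\<^sub>v 14, E\<^sub>v 6, D\<^sub>v 8] ! i"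

fun tau_ln :: "bs_vertex \<Rightarrow> bs_vertex" where
  "tau_ln (A\<^sub>v i) =
     [A\<^sub>v 0, E\<^sub>v 6, E\<^sub>v 9, D\<^sub>v 2, F\<^sub>v 5, A\<^sub>v 5, A\<^sub>v 6, F\<^sub>v 6, D\<^sub>v 9, E\<^sub>v 2, E\<^sub>v 5, A\<^sub>v 11,
      B\<^sub>v 6, F\<^sub>v 9, D\<^sub>v 14, F\<^sub>v 2, B\<^sub>v 5] ! i" |
  "tau_ln (B\<^sub>v i) =
     [B\<^sub>v 0, D\<^sub>v 6, B\<^sub>v 9, D\<^sub>v 7, F\<^sub>v 8, A\<^sub>v 16, A\<^sub>v 12, F\<^sub>v 3, D\<^sub>v 4, B\<^sub>v 2, D\<^sub>v 5,
      B\<^sub>v 11, C\<^sub>v 6, F\<^sub>v 12, E\<^sub>v 14, F\<^sub>v 16, C\<^sub>v 5] ! i" |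
  "tau_ln (C\<^sub>v i) =
     [E\<^sub>v 0, D\<^sub>v 11, C\<^sub>v 9, D\<^sub>v 12, F\<^sub>v 11, B\<^sub>v 16, B\<^sub>v 12, F\<^sub>v 0, D\<^sub>v 16, C\<^sub>v 2, D\<^sub>v 0,
      E\<^sub>v 11, C\<^sub>v 16, E\<^sub>v 12, F\<^sub>v 14, E\<^sub>v 16, C\<^sub>v 12] ! i" |
  "tau_ln (D\<^sub>v i) =
     [C\<^sub>v 10, E\<^sub>v 1, A\<^sub>v 3, F\<^sub>v 7, B\<^sub>v 8, B\<^sub>v 10, B\<^sub>v 1, B\<^sub>v 3, F\<^sub>v 4, A\<^sub>v 8, E\<^sub>v 10,
      C\<^sub>v 1, C\<^sub>v 3, F\<^sub>v 1, A\<^sub>v 14, F\<^sub>v 10, C\<^sub>v 8] ! i" |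
  "tau_ln (E\<^sub>v i) =
     [C\<^sub>v 0, D\<^sub>v 1, A\<^sub>v 9, E\<^sub>v 7, E\<^sub>v 8, A\<^sub>v 10, A\<^sub>v 1, E\<^sub>v 3, E\<^sub>v 4, A\<^sub>v 2, D\<^sub>v 10,
      C\<^sub>v 11, C\<^sub>v 13, F\<^sub>v 15, B\<^sub>v 14, F\<^sub>v 13, C\<^sub>v 15] ! i" |
  "tau_ln (F\<^sub>v i) =
     [C\<^sub>v 7, D\<^sub>v 13, A\<^sub>v 15, B\<^sub>v 7, D\<^sub>v 8, A\<^sub>v 4, A\<^sub>v 7, D\<^sub>v 3, B\<^sub>v 4, A\<^sub>v 13, D\<^sub>v 15,
      C\<^sub>v 4, B\<^sub>v 13, E\<^sub>v 15, C\<^sub>v 14, E\<^sub>v 13, B\<^sub>v 15] ! i"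

text \<open>Distances in the Levi graph from the point \<open>D\<^sub>3\<close>.\<close>

fun lev_pt :: "bs_vertex \<Rightarrow> nat" where
  "lev_pt (A\<^sub>v i) =
     [4, 4, 4, 2, 4, 4, 4, 4, 4, 4, 6, 4, 4, 6, 4, 4, 4] ! i" |
  "lev_pt (B\<^sub>v i) =
     [4, 2, 4, 4, 4, 2, 4, 4, 6, 4, 4, 4, 4, 4, 4, 6, 4] ! i" |
  "lev_pt (C\<^sub>v i) =
     [6, 4, 4, 2, 4, 4, 6, 4, 4, 4, 4, 4, 4, 4, 4, 4, 4] ! i" |
  "lev_pt (D\<^sub>v i) =
     [6, 6, 4, 0, 4, 6, 6, 4, 4, 2, 4, 4, 4, 4, 2, 4, 4] ! i" |
  "lev_pt (E\<^sub>v i) =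
     [4, 4, 4, 6, 4, 4, 4, 2, 4, 4, 4, 4, 4, 4, 4, 4, 2] ! i" |
  "lev_pt (F\<^sub>v i) =
     [4, 2, 4, 4, 4, 2, 4, 4, 4, 4, 4, 2, 2, 4, 4, 4, 4] ! i"

fun lev_ln :: "bs_vertex \<Rightarrow> nat" where
  "lev_ln (A\<^sub>v i) =
     [5, 3, 5, 3, 5, 3, 5, 5, 5, 3, 3, 3, 3, 3, 3, 5, 5] ! i" |
  "lev_ln (B\<^sub>v i) =
     [1, 5, 5, 5, 5, 5, 1, 3, 5, 5, 3, 3, 3, 3, 5, 5, 3] ! i" |
  "lev_ln (C\<^sub>v i) =
     [5, 5, 5, 1, 5, 5, 5, 3, 5, 3, 5, 5, 5, 5, 3, 5, 3] ! i" |
  "lev_ln (D\<^sub>v i) =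
     [3, 3, 5, 3, 5, 3, 3, 5, 3, 5, 5, 3, 3, 5, 5, 3, 5] ! i" |
  "lev_ln (E\<^sub>v i) =
     [5, 5, 5, 5, 5, 5, 5, 5, 5, 3, 3, 5, 5, 3, 3, 5, 5] ! i" |
  "lev_ln (F\<^sub>v i) =
     [5, 5, 5, 1, 5, 5, 5, 5, 5, 3, 5, 3, 3, 5, 3, 5, 5] ! i"

section \<open>Finite checks on the tables\<close>

lemma card_filter_V: "card {v\<in>V. P v} = length (filter P
   (map A\<^sub>v [0..<17] @ map B\<^sub>v [0..<17] @ map C\<^sub>v [0..<17] @
    map D\<^sub>v [0..<17] @ map E\<^sub>v [0..<17] @ map F\<^sub>v [0..<17]))" (is "_ = length (filter P ?xs)")
proof -
  \<comment> \<open>Listing \<open>V\<close> without repetition turns a cardinality into the length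
    of a filtered list, which can be computed.\<close>
  have "V = set ?xs" unfolding V_eq by auto
  moreover have "distinct ?xs" by (auto simp: distinct_map inj_on_def)
  ultimately show ?thesis
    by (simp only: distinct_card[OF distinct_filter, symmetric] set_filter)
qed

lemma upt_0_17: "[0..<17] = [0, 1, 2, 3, 4, 5, 6, 7, 8, 9, 10, 11, 12, 13, 14, 15, 16]"
  by (simp add: upt_rec)

lemma card_V: "card V = 102" and finite_V: "finite V"
proof -
  show "card V = 102" using card_filter_V[of "\<lambda>_. True"] by (simp add: Collect_mem_eq)
  show "finite V" by (simp add: V_eq)
qed

lemma distinct_nbs: "\<forall>v\<in>V. distinct (nbs v) \<and> length (nbs v) = 3"
  unfolding check_V by simp

lemma distinct_line: "\<forall>w\<in>V. distinct (line_pts w) \<and> length (line_pts w) = 4"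
  unfolding check_V by simp

lemma line_subset: "w \<in> V \<Longrightarrow> set (line_pts w) \<subseteq> V"
  by (cases w) auto

lemma distinct_pt_lines: "\<forall>v\<in>V. distinct (pt_lines v) \<and> length (pt_lines v) = 4"
  unfolding check_V by simp

lemma pt_lines_subset: "v \<in> V \<Longrightarrow> set (pt_lines v) \<subseteq> V"
  by (cases v) auto

lemma in_line_iff:
  assumes "v \<in> V" "w \<in> V"
  shows "v \<in> set (line_pts w) \<longleftrightarrow> w \<in> set (pt_lines v)"
proof -
  have "\<forall>w\<in>V. \<forall>x\<in>set (line_pts w). w \<in> set (pt_lines x)"
    unfolding check_V by simp
  moreover have "\<forall>v\<in>V. \<forall>x\<in>set (pt_lines v). v \<in> set (line_pts x)"
    unfolding check_V by simp
  ultimately show ?thesis using assms by blast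
qed

lemma shift_line: "\<forall>w\<in>V. \<forall>x\<in>set (line_pts w). affine 1 1 x \<in> set (line_pts (affine 1 1 w))"
  unfolding check_V by simp

lemma shift_nbs: "\<forall>v\<in>V. \<forall>x\<in>set (nbs v). affine 1 1 x \<in> set (nbs (affine 1 1 v))"
  unfolding check_V by simp

lemma mu_line:
  "\<forall>w\<in>V. \<forall>x\<in>set (line_pts w). turn (affine 2 0 x) \<in> set (line_pts (turn (affine 2 0 w)))"
  unfolding check_V by simp

lemma mu_nbs: "\<forall>v\<in>V. \<forall>x\<in>set (nbs v). turn (affine 2 0 x) \<in> set (nbs (turn (affine 2 0 v)))"
  unfolding check_V by simp

lemma tau_line: "\<forall>w\<in>V. \<forall>x\<in>set (line_pts w). tau_pt x \<in> set (line_pts (tau_ln w))"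
  unfolding check_V by simp

lemma tau_nbs: "\<forall>v\<in>V. \<forall>x\<in>set (nbs v). tau_pt x \<in> set (nbs (tau_pt v))"
  unfolding check_V by simp

lemma tau_involution:
  "\<forall>v\<in>V. tau_pt v \<in> V \<and> tau_ln v \<in> V \<and> tau_pt (tau_pt v) = v \<and> tau_ln (tau_ln v) = v"
  unfolding check_V by simp

text \<open>Multiplication by 6 reverses incidence. The line side carries the extra
  \<open>turn\<close>, so that the point map followed by the line map is \<open>mu\<close>, since 36
  is 2 modulo 17.\<close>

lemma nu_line: "\<forall>w\<in>V. \<forall>x\<in>set (line_pts w). turn (affine 6 0 w) \<in> set (line_pts (affine 6 0 x))"
  unfolding check_V by simp

lemma turn_in_V [simp]: "turn v \<in> V \<longleftrightarrow> v \<in> V"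
  by (cases v) auto

lemma affine_in_V [simp]: "affine m b v \<in> V"
  by (cases v) auto

lemma affine_Suc: "affine 1 1 (affine 1 k v) = affine 1 (Suc k) v"
  by (cases v) (simp_all add: mod_Suc_eq)

lemma bij_V:
  assumes "\<forall>v\<in>V. g v \<in> V \<and> h v \<in> V \<and> h (g v) = v \<and> g (h v) = v"
  shows "bij_betw g V V"
  by (rule bij_betw_byWitness[of _ h]) (use assms in auto)

lemma bij_affine: "bij_betw (affine 1 1) V V" "bij_betw (affine 2 0) V V" "bij_betw (affine 6 0) V V"
proof -
  \<comment> \<open>Inverses modulo 17: 16 is -1, 9 inverts 2, and 3 inverts 6.\<close>
  have "\<forall>v\<in>V. affine 1 16 (affine 1 1 v) = v \<and> affine 1 1 (affine 1 16 v) = v"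
    "\<forall>v\<in>V. affine 9 0 (affine 2 0 v) = v \<and> affine 2 0 (affine 9 0 v) = v"
    "\<forall>v\<in>V. affine 3 0 (affine 6 0 v) = v \<and> affine 6 0 (affine 3 0 v) = v"
    unfolding check_V by simp_all
  then show "bij_betw (affine 1 1) V V" "bij_betw (affine 2 0) V V" "bij_betw (affine 6 0) V V"
    by (simp_all add: bij_V[of _ "affine 1 16"] bij_V[of _ "affine 9 0"] bij_V[of _ "affine 3 0"])
qed

lemma bij_turn: "bij_betw turn V V"
  \<comment> \<open>\<open>turn\<close> has order four, so its cube is its inverse.\<close>
  by (rule bij_V[of _ "turn \<circ> turn \<circ> turn"]) (auto simp: V_eq)

lemma bij_tau: "bij_betw tau_pt V V" "bij_betw tau_ln V V"
  using tau_involution by (auto intro: bij_V[of _ tau_pt] bij_V[of _ tau_ln])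

text \<open>This and the next two checks feed \<open>distance_levels\<close>: incident points and
  lines are exactly one level apart, and from every line, and from every point other than
  \<open>D\<^sub>v 3\<close>, one can descend by one level.\<close>

lemma lev_flag:
  "\<forall>w\<in>V. \<forall>x\<in>set (line_pts w). lev_pt x = Suc (lev_ln w) \<or> lev_ln w = Suc (lev_pt x)"
  unfolding check_V by simp

lemma lev_ln_pred: "\<forall>w\<in>V. \<exists>x\<in>set (line_pts w). lev_ln w = Suc (lev_pt x)"
  unfolding check_V by simp

lemma lev_pt_pred:
  "\<forall>v\<in>V. if v = D\<^sub>v 3 then lev_pt v = 0 else \<exists>w\<in>set (pt_lines v). lev_pt v = Suc (lev_ln w)"
  unfolding check_V by simp

lemma lev_pt_even: "\<forall>v\<in>V. even (lev_pt v) \<and> lev_pt v \<le> 6"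
  unfolding check_V by simp

lemma lev_ln_odd: "\<forall>v\<in>V. odd (lev_ln v) \<and> lev_ln v \<le> 5"
  unfolding check_V by simp

lemma card_lev_pt:
  "card {v\<in>V. lev_pt v = 0} = 1" "card {v\<in>V. lev_pt v = 2} = 12"
  "card {v\<in>V. lev_pt v = 4} = 78" "card {v\<in>V. lev_pt v = 6} = 11"
  unfolding card_filter_V upt_0_17 by simp_all

lemma card_lev_ln:
  "card {w\<in>V. lev_ln w = 1} = 4" "card {w\<in>V. lev_ln w = 3} = 36" "card {w\<in>V. lev_ln w = 5} = 62"
  unfolding card_filter_V upt_0_17 by simp_all

text \<open>The only computation behind \<open>unique_line\<close>; transitivity on ordered pairs of
  points of a line spreads it to all pairs.\<close>

lemma base_pencil:
  "\<forall>w\<in>set (pt_lines (D\<^sub>v 3)). F\<^sub>v 12 \<in> set (line_pts w) \<longrightarrow> w = B\<^sub>v 0"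
  by simp

lemma nbs_subset: "v \<in> V \<Longrightarrow> set (nbs v) \<subseteq> V"
  by (cases v) auto

text \<open>An undirected edge of step \<open>d\<close> on the 17-cycle of indices can be traversed
  forwards or backwards. This matches the union of two-element sets in \<open>biggs_smith\<close>
  with the oriented entries of \<open>nbs\<close>.\<close>

lemma cyclic_edge:
  fixes i j d :: nat
  assumes "d \<le> 17"
  shows "(\<exists>x\<in>{..<17}. i = x \<and> j = (x + d) mod 17 \<or> i = (x + d) mod 17 \<and> j = x) \<longleftrightarrow>
    i < 17 \<and> (j = (i + d) mod 17 \<or> j = (i + (17 - d)) mod 17)"
proof -
  \<comment> \<open>All sums that occur are below 34, so one conditional subtraction removes the
    modulus and leaves linear arithmetic.\<close>
  have "x mod 17 = (if x < 17 then x else x - 17)" if "x < 34" for x :: nat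
    using that by (simp add: le_mod_geq)
  then have "i = (j + d) mod 17 \<longleftrightarrow> j = (i + (17 - d)) mod 17" if "i < 17" "j < 17"
    using assms that by auto
  moreover have "(i + (17 - d)) mod 17 < 17" "(j + d) mod 17 < 17" by simp_all
  ultimately show ?thesis by (metis lessThan_iff)
qed

lemma adjacent_biggs_smith: "adjacent biggs_smith u v \<longleftrightarrow> u \<in> V \<and> v \<in> set (nbs u)"
  unfolding adjacent_def biggs_smith_def
  by (cases u; cases v) (simp_all add: doubleton_eq_iff cyclic_edge[of 1, simplified]
      cyclic_edge[of 2, simplified] cyclic_edge[of 4, simplified] cyclic_edge[of 8, simplified])

section \<open>The symmetry group\<close>

abbreviation L :: "bs_vertex \<Rightarrow> bs_vertex set" where
  "L w \<equiv> set (line_pts w)"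

lemma card_line: "w \<in> V \<Longrightarrow> card (L w) = 4"
  using distinct_line distinct_card by metis

text \<open>An automorphism \<open>g\<close> of the Biggs-Smith graph that permutes the lines,
  paired with the permutation \<open>h\<close> of line labels it induces. Keeping \<open>h\<close>
  explicit lets lines be followed by label.\<close>

definition symmetry :: "(bs_vertex \<Rightarrow> bs_vertex) \<Rightarrow> (bs_vertex \<Rightarrow> bs_vertex) \<Rightarrow> bool" where
  "symmetry g h \<longleftrightarrow> graph_aut g biggs_smith \<and> bij_betw h V V \<and> (\<forall>w\<in>V. L (h w) = g ` L w)"

text \<open>One-sided inclusions, which are what the table checks provide, suffice: \<open>g\<close>
  is injective, and all lines have four points and all vertices three neighbours, so the inclusions
  are equalities.\<close>

lemma symmetryI:
  assumes g: "bij_betw g V V" and h: "bij_betw h V V"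
    and line: "\<forall>w\<in>V. \<forall>x\<in>L w. g x \<in> L (h w)"
    and nbs: "\<forall>v\<in>V. \<forall>x\<in>set (nbs v). g x \<in> set (nbs (g v))"
  shows "symmetry g h"
proof -
  have inj: "inj_on g A" if "A \<subseteq> V" for A
    using g that by (meson bij_betw_def inj_on_subset)
  have gV: "g v \<in> V" "h v \<in> V" if "v \<in> V" for v
    using g h that by (auto dest: bij_betwE)
  have "L (h w) = g ` L w" if "w \<in> V" for w
  proof (rule card_subset_eq[symmetric])
    show "card (g ` L w) = card (L (h w))"
      using that by (simp add: card_image inj line_subset card_line gV)
  qed (use line that in auto)
  moreover have nbs_eq: "set (nbs (g v)) = g ` set (nbs v)" if "v \<in> V" for v
  proof (rule card_subset_eq[symmetric])
    show "card (g ` set (nbs v)) = card (set (nbs (g v)))"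
      using that gV(1)[OF that] distinct_nbs by (simp add: card_image inj nbs_subset distinct_card)
  qed (use nbs that in auto)
  then have "graph_aut g biggs_smith"
    unfolding graph_aut_def graph_iso_def adjacent_biggs_smith
    using g gV inj_on_image_mem_iff[OF inj[OF subset_refl] _ nbs_subset] by auto
  ultimately show ?thesis using h by (simp add: symmetry_def)
qed

lemma symmetry_shift: "symmetry (affine 1 1) (affine 1 1)"
  by (rule symmetryI[OF bij_affine(1) bij_affine(1) shift_line shift_nbs])

definition mu :: "bs_vertex \<Rightarrow> bs_vertex" where
  [simp]: "mu v = turn (affine 2 0 v)"

lemma symmetry_mu: "symmetry mu mu"
proof -
  have "bij_betw mu V V"
    using bij_betw_trans[OF bij_affine(2) bij_turn] by (simp add: comp_def mu_def[abs_def])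
  then show ?thesis using mu_line mu_nbs by (intro symmetryI) auto
qed

lemma symmetry_tau: "symmetry tau_pt tau_ln"
  by (rule symmetryI[OF bij_tau tau_line tau_nbs])

lemma symmetry_comp: "symmetry g h \<Longrightarrow> symmetry g' h' \<Longrightarrow> symmetry (g' \<circ> g) (h' \<circ> h)"
  unfolding symmetry_def
  by (auto intro: graph_aut_comp bij_betw_trans simp: bij_betwE image_image)

lemma symmetry_id: "symmetry id id"
  by (simp add: symmetry_def graph_aut_def graph_iso_def)

lemma symmetry_aut: "symmetry g h \<Longrightarrow> graph_aut g biggs_smith"
  by (simp add: symmetry_def)

lemma symmetry_in_V: "symmetry g h \<Longrightarrow> v \<in> V \<Longrightarrow> g v \<in> V" "symmetry g h \<Longrightarrow> v \<in> V \<Longrightarrow> h v \<in> V"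
  by (auto simp: symmetry_def graph_aut_in_verts dest: bij_betwE)

lemma symmetry_inj: "symmetry g h \<Longrightarrow> u \<in> V \<Longrightarrow> v \<in> V \<Longrightarrow> g u = g v \<longleftrightarrow> u = v"
  by (rule graph_aut_eq_iff[OF symmetry_aut])

lemma symmetry_line: "symmetry g h \<Longrightarrow> w \<in> V \<Longrightarrow> L (h w) = g ` L w"
  by (simp add: symmetry_def)

lemma symmetry_in_line_iff: "symmetry g h \<Longrightarrow> v \<in> V \<Longrightarrow> w \<in> V \<Longrightarrow> g v \<in> L (h w) \<longleftrightarrow> v \<in> L w"
  using line_subset by (auto simp: symmetry_line symmetry_inj subset_iff)

lemma symmetry_surj: "symmetry g h \<Longrightarrow> v \<in> V \<Longrightarrow> \<exists>u\<in>V. g u = v" "symmetry g h \<Longrightarrow> w \<in> V \<Longrightarrow> \<exists>u\<in>V. h u = w"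
  unfolding symmetry_def by (metis bij_betw_imp_surj_on graph_aut_bij imageE)+

section \<open>Orbits of lines, ordered lines and points\<close>

lemma line_orbit:
  assumes "w \<in> V"
  shows "\<exists>g h. symmetry g h \<and> h (B\<^sub>v 0) = w"
proof -
  define Orb where "Orb = {w. \<exists>g h. symmetry g h \<and> h (B\<^sub>v 0) = w}"
  have base: "B\<^sub>v 0 \<in> Orb" using symmetry_id Orb_def by force
  have step: "h w \<in> Orb" if "w \<in> Orb" "symmetry g h" for w g h
    using that symmetry_comp by (fastforce simp: Orb_def)
  have shift: "affine 1 k w \<in> Orb" if "w \<in> Orb" "w \<in> V" for w k
  proof (induction k)
    case 0
    have "affine 1 0 w = w" using that(2) by (cases w) auto
    with that(1) show ?case by simp
  next
    case (Suc k)
    then show ?case using step[OF Suc symmetry_shift] by (simp only: affine_Suc)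
  qed
  have B: "B\<^sub>v i \<in> Orb" if "i < 17" for i
    using shift[OF base, of i] that by simp
  have E: "E\<^sub>v i \<in> Orb" if "i < 17" for i
    using shift[OF step[OF base symmetry_mu], of i] that by simp
  \<comment> \<open>Rotations keep the letter, and \<open>mu\<close> only exchanges
    \<open>B\<^sub>v\<close> with \<open>E\<^sub>v\<close> and cycles the other four.
    \<open>tau_ln\<close> supplies the link between these two classes by sending
    \<open>B\<^sub>v 1\<close> to \<open>D\<^sub>v 6\<close>.\<close>
  have D6: "D\<^sub>v 6 \<in> Orb"
    using step[OF B[of 1] symmetry_tau] by simp
  have C: "C\<^sub>v 12 \<in> Orb"
    using step[OF D6 symmetry_mu] by simp
  have F: "F\<^sub>v 7 \<in> Orb"
    using step[OF C symmetry_mu] by simp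
  have A: "A\<^sub>v 14 \<in> Orb"
    using step[OF F symmetry_mu] by simp
  have "A\<^sub>v i \<in> Orb" "C\<^sub>v i \<in> Orb" "D\<^sub>v i \<in> Orb" "F\<^sub>v i \<in> Orb" if "i < 17" for i
    \<comment> \<open>Each offset completes the index of the known representative to 17, which
      leaves index \<open>i\<close>.\<close>
    using shift[OF A, of "i + 3"] shift[OF C, of "i + 5"] shift[OF D6, of "i + 11"]
      shift[OF F, of "i + 10"] that by simp_all
  with assms B E have "w \<in> Orb" by (cases w) auto
  then show ?thesis by (simp add: Orb_def)
qed

text \<open>Once a line is reached, precomposing with elements that fix \<open>B\<^sub>v 0\<close>
  rearranges its points. A 4-cycle and a transposition of neighbours generate all 24 orders.\<close>

lemma line_sorted_orbit:
  assumes "w \<in> V" "distinct xs" "set xs = L w"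
  shows "\<exists>g h. symmetry g h \<and> h (B\<^sub>v 0) = w \<and> map g (line_pts (B\<^sub>v 0)) = xs"
proof -
  define P where "P a b c d \<longleftrightarrow> (\<exists>g h. symmetry g h \<and> h (B\<^sub>v 0) = w \<and>
      map g (line_pts (B\<^sub>v 0)) = [a, b, c, d])" for a b c d
  have rot: "P b c d a" if P: "P a b c d" for a b c d
  proof -
    obtain g h where gh: "symmetry g h" "h (B\<^sub>v 0) = w" "map g (line_pts (B\<^sub>v 0)) = [a, b, c, d]"
      using P unfolding P_def by metis
    \<comment> \<open>\<open>mu\<close> exchanges the lines \<open>B\<^sub>v 0\<close> and
      \<open>E\<^sub>v 0\<close>, so its square is what fixes \<open>B\<^sub>v 0\<close>.\<close>
    have "symmetry (g \<circ> (mu \<circ> mu)) (h \<circ> (mu \<circ> mu))"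
      by (intro symmetry_comp symmetry_mu gh)
    moreover have "(h \<circ> (mu \<circ> mu)) (B\<^sub>v 0) = w"
      "map (g \<circ> (mu \<circ> mu)) (line_pts (B\<^sub>v 0)) = [b, c, d, a]"
      using gh by auto
    ultimately show ?thesis unfolding P_def by (intro exI conjI)
  qed
  have swap: "P b a c d" if P: "P a b c d" for a b c d
  proof -
    obtain g h where gh: "symmetry g h" "h (B\<^sub>v 0) = w" "map g (line_pts (B\<^sub>v 0)) = [a, b, c, d]"
      using P unfolding P_def by metis
    have "symmetry (g \<circ> tau_pt) (h \<circ> tau_ln)"
      by (intro symmetry_comp symmetry_tau gh)
    moreover have "(h \<circ> tau_ln) (B\<^sub>v 0) = w"
      "map (g \<circ> tau_pt) (line_pts (B\<^sub>v 0)) = [b, a, c, d]"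
      using gh by auto
    ultimately show ?thesis unfolding P_def by (intro exI conjI)
  qed
  \<comment> \<open>Conjugating the transposition of the first two places by the rotation moves it
    one place further.\<close>
  have swap2: "P a c b d" if "P a b c d" for a b c d
    by (rule rot[OF rot[OF rot[OF swap[OF rot[OF that]]]]])
  have swap3: "P a b d c" if "P a b c d" for a b c d
    by (rule rot[OF rot[OF rot[OF swap2[OF rot[OF that]]]]])
  obtain g h where gh: "symmetry g h" "h (B\<^sub>v 0) = w" using line_orbit[OF assms(1)] by blast
  obtain a b c d where abcd: "map g (line_pts (B\<^sub>v 0)) = [a, b, c, d]" by simp
  have "P a b c d" using gh abcd unfolding P_def by (intro exI conjI)
  have "L w = g ` L (B\<^sub>v 0)"
    using symmetry_line[OF gh(1), of "B\<^sub>v 0"] gh(2) by simp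
  also have "\<dots> = {a, b, c, d}"
    by (metis abcd list.set_map empty_set list.simps(15))
  finally have Lw: "L w = {a, b, c, d}" .
  have "length xs = 4"
    using assms card_line distinct_card by metis
  then obtain a' b' c' d' where xs: "xs = [a', b', c', d']"
    by (auto simp: length_Suc_conv eval_nat_numeral)
  \<comment> \<open>Sorting by position: rotations bring \<open>a'\<close> to the front, then
    transpositions of neighbours bring \<open>b'\<close> and \<open>c'\<close> to their places, and
    the last entry is forced.\<close>
  have "a' \<in> {a, b, c, d}" using Lw assms(3) xs by auto
  then obtain b1 c1 d1 where 1: "P a' b1 c1 d1" "{a', b1, c1, d1} = {a, b, c, d}"
    using \<open>P a b c d\<close> rot by (elim insertE emptyE) (blast | fast)+
  have "b' \<in> {b1, c1, d1}" using Lw assms(2,3) xs 1(2) by auto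
  then obtain c2 d2 where 2: "P a' b' c2 d2" "{a', b', c2, d2} = {a, b, c, d}"
    using 1 swap2 swap3 by (elim insertE emptyE) blast+
  have "c' \<in> {c2, d2}" using Lw assms(2,3) xs 2(2) by auto
  then obtain d3 where 3: "P a' b' c' d3" "{a', b', c', d3} = {a, b, c, d}"
    using 2 swap3 by (elim insertE emptyE) blast+
  have "d' = d3" using Lw assms(2,3) xs 3(2) by auto
  with 3 xs show ?thesis by (simp add: P_def)
qed

text \<open>Two points of a line extend to an ordering of the whole line, so the group is transitive
  on ordered pairs of collinear points, with base pair \<open>D\<^sub>v 3\<close>,
  \<open>F\<^sub>v 12\<close> on \<open>B\<^sub>v 0\<close>.\<close>

lemma arc_orbit:
  assumes w: "w \<in> V" "a \<in> L w" "b \<in> L w" "a \<noteq> b"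
  shows "\<exists>g h. symmetry g h \<and> h (B\<^sub>v 0) = w \<and> g (D\<^sub>v 3) = a \<and> g (F\<^sub>v 12) = b"
proof -
  obtain xs where "distinct xs" "set xs = L w - {a, b}"
    using finite_distinct_list[of "L w - {a, b}"] by auto
  with w have "distinct (a # b # xs)" "set (a # b # xs) = L w" by auto
  from line_sorted_orbit[OF w(1) this] show ?thesis by auto
qed

lemma line_through:
  assumes "v \<in> V"
  shows "\<exists>w\<in>V. v \<in> L w"
proof -
  have "hd (pt_lines v) \<in> set (pt_lines v)" by (cases v) auto
  then show ?thesis using assms pt_lines_subset in_line_iff by blast
qed

lemma point_orbit:
  assumes "v \<in> V"
  shows "\<exists>g h. symmetry g h \<and> g (D\<^sub>v 3) = v"
proof -
  obtain w where w: "w \<in> V" "v \<in> L w" using line_through assms by blast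
  have "L w \<noteq> {v}" using card_line[OF w(1)] by auto
  with w obtain b where "b \<in> L w" "b \<noteq> v" by blast
  with arc_orbit[of w v b] w show ?thesis by blast
qed

text \<open>Pulling the pair back to \<open>D\<^sub>v 3\<close>, \<open>F\<^sub>v 12\<close> makes
  the second line one of the four through \<open>D\<^sub>v 3\<close>, where
  \<open>base_pencil\<close> decides.\<close>

lemma unique_line:
  assumes w: "w \<in> V" "w' \<in> V" and ab: "a \<noteq> b" "{a, b} \<subseteq> L w" "{a, b} \<subseteq> L w'"
  shows "w = w'"
proof -
  obtain g h where gh: "symmetry g h" "h (B\<^sub>v 0) = w" "g (D\<^sub>v 3) = a" "g (F\<^sub>v 12) = b"
    using arc_orbit[of w a b] w ab by auto
  obtain w'' where w'': "w'' \<in> V" "h w'' = w'" using symmetry_surj(2)[OF gh(1) w(2)] by blast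
  then have "g (D\<^sub>v 3) \<in> L (h w'')" "g (F\<^sub>v 12) \<in> L (h w'')"
    using ab(3) gh(3,4) by simp_all
  then have "D\<^sub>v 3 \<in> L w''" "F\<^sub>v 12 \<in> L w''"
    using symmetry_in_line_iff[OF gh(1) _ w''(1)] by simp_all
  moreover have "D\<^sub>v 3 \<in> V" by simp
  ultimately have "w'' = B\<^sub>v 0" using base_pencil in_line_iff[OF _ w''(1)] by blast
  with w'' gh show ?thesis by simp
qed

lemma inj_L: "inj_on L V"
proof (rule inj_onI)
  fix w w' assume w: "w \<in> V" "w' \<in> V" "L w = L w'"
  have "card (L w) > 1" using card_line w by simp
  then obtain a b where "a \<in> L w" "b \<in> L w" "a \<noteq> b"
    by (metis card_le_Suc0_iff_eq finite_set linorder_not_le One_nat_def)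
  with w show "w = w'" by (intro unique_line[of w w' a b]) auto
qed

section \<open>Collinearity\<close>

definition coll :: "bs_vertex \<Rightarrow> bs_vertex \<Rightarrow> bool" where
  "coll u v \<longleftrightarrow> u \<noteq> v \<and> (\<exists>w\<in>V. u \<in> L w \<and> v \<in> L w)"

lemma coll_in_V: "coll u v \<Longrightarrow> u \<in> V \<and> v \<in> V"
  using line_subset by (auto simp: coll_def)

text \<open>Makes collinearity with a concrete point computable.\<close>

lemma coll_iff: "v \<in> V \<Longrightarrow> coll v u \<longleftrightarrow> v \<noteq> u \<and> (\<exists>w\<in>set (pt_lines v). u \<in> L w)"
  using in_line_iff pt_lines_subset unfolding coll_def by blast

lemma symmetry_coll:
  assumes gh: "symmetry g h" and uv: "u \<in> V" "v \<in> V"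
  shows "coll (g u) (g v) \<longleftrightarrow> coll u v"
proof -
  have "(\<exists>w\<in>V. g u \<in> L w \<and> g v \<in> L w) \<longleftrightarrow> (\<exists>w\<in>V. g u \<in> L (h w) \<and> g v \<in> L (h w))"
    using symmetry_surj(2)[OF gh] symmetry_in_V(2)[OF gh] by metis
  then show ?thesis
    using uv
    by (simp add: coll_def symmetry_inj[OF gh] symmetry_in_line_iff[OF gh] cong: bex_cong_simp)
qed

lemma coll_orbit:
  assumes "coll u v"
  shows "\<exists>g h. symmetry g h \<and> g (D\<^sub>v 3) = u \<and> g (F\<^sub>v 12) = v"
  using assms arc_orbit unfolding coll_def by metis

text \<open>Every triangle of the collinearity graph lies within a line. It suffices to check that
  all points collinear with both \<open>D\<^sub>v 3\<close> and \<open>F\<^sub>v 12\<close> lie on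
  \<open>B\<^sub>v 0\<close>. This is what makes the lines the only copies of
  \<open>K_4\<close>.\<close>

lemma triangle_in_line:
  assumes "coll a b" "coll a c" "coll b c" and w: "w \<in> V" "a \<in> L w" "b \<in> L w"
  shows "c \<in> L w"
proof -
  have "a \<noteq> b" using assms(1) by (simp add: coll_def)
  then obtain g h where gh: "symmetry g h" "h (B\<^sub>v 0) = w" "g (D\<^sub>v 3) = a" "g (F\<^sub>v 12) = b"
    using arc_orbit[of w a b] w by auto
  obtain c' where c': "c' \<in> V" "g c' = c"
    using symmetry_surj(1)[OF gh(1)] coll_in_V[OF assms(2)] by blast
  then have "coll (D\<^sub>v 3) c'" "coll (F\<^sub>v 12) c'"
    using assms(2,3) gh(3,4) c'(2) symmetry_coll[OF gh(1), of "D\<^sub>v 3" c']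
      symmetry_coll[OF gh(1), of "F\<^sub>v 12" c'] by auto
  then have "c' \<in> L (B\<^sub>v 0)" by (auto simp: coll_iff)
  then have "g c' \<in> L (h (B\<^sub>v 0))" using symmetry_in_line_iff[OF gh(1) c'(1), of "B\<^sub>v 0"] by simp
  then show ?thesis using c' gh by simp
qed

section \<open>Nine-cycles and collinearity\<close>

definition nine_cycle_thirds :: "bs_vertex \<Rightarrow> bs_vertex \<Rightarrow> bool" where
  "nine_cycle_thirds u v \<longleftrightarrow> (\<exists>c i. graph_cycle biggs_smith c \<and> length c = 9 \<and> i < 9 \<and>
     {u, v} = {c ! i, c ! ((i + 3) mod 9)})"

lemma nine_cycle_thirds_map:
  assumes g: "graph_aut g biggs_smith" and "nine_cycle_thirds u v"
  shows "nine_cycle_thirds (g u) (g v)"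
proof -
  obtain c i where c: "graph_cycle biggs_smith c" "length c = 9" "i < 9"
    "{u, v} = {c ! i, c ! ((i + 3) mod 9)}" using assms(2) by (auto simp: nine_cycle_thirds_def)
  then have "{g u, g v} = {map g c ! i, map g c ! ((i + 3) mod 9)}"
    by (auto simp: doubleton_eq_iff)
  then show ?thesis
    using graph_cycle_map[OF g c(1)] c(2,3) unfolding nine_cycle_thirds_def
    by (intro exI[of _ "map g c"] exI[of _ i]) simp
qed

text \<open>Of the 9-cycle only the path of length three between the two vertices is kept, which
  leaves few enough cases to enumerate.\<close>

lemma nine_cycle_thirds_path:
  assumes "nine_cycle_thirds u v"
  shows "\<exists>x y. x \<in> set (nbs u) \<and> y \<in> set (nbs x) \<and> y \<noteq> u \<and> v \<in> set (nbs y) \<and> v \<noteq> x"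
proof -
  obtain c i where c: "graph_cycle biggs_smith c" "length c = 9" "i < 9"
    "{u, v} = {c ! i, c ! ((i + 3) mod 9)}" using assms by (auto simp: nine_cycle_thirds_def)
  define p where "p k = c ! ((i + k) mod 9)" for k
  have adj: "adjacent biggs_smith (p k) (p (Suc k))" for k
  proof -
    have "((i + k) mod 9 + 1) mod 9 = (i + Suc k) mod 9" by (simp add: mod_Suc_eq)
    moreover have "(i + k) mod 9 < 9" by simp
    ultimately show ?thesis using c(1,2) unfolding p_def graph_cycle_def by metis
  qed
  have neq: "p k \<noteq> p (k + 2)" for k
  proof -
    have "m \<noteq> (m + 2) mod 9" if "m < 9" for m :: nat
      using that by (auto simp: mod_if)
    then have "(i + k) mod 9 \<noteq> ((i + k) mod 9 + 2) mod 9" by simp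
    then have "(i + k) mod 9 \<noteq> (i + (k + 2)) mod 9" by (simp add: mod_simps add.assoc)
    then show ?thesis using c(1,2) by (simp add: p_def graph_cycle_def nth_eq_iff_index_eq)
  qed
  \<comment> \<open>Both directions are recorded because the unordered pair may have
    \<open>u\<close> at either end of the path.\<close>
  have path: "p 1 \<in> set (nbs (p 0))" "p 2 \<in> set (nbs (p 1))" "p 3 \<in> set (nbs (p 2))"
    "p 0 \<in> set (nbs (p 1))" "p 1 \<in> set (nbs (p 2))" "p 2 \<in> set (nbs (p 3))"
    using adj[of 0] adj[of 1] adj[of 2] adjacent_commute[of biggs_smith]
    by (auto simp: adjacent_biggs_smith numeral_eq_Suc)
  have "p 0 \<noteq> p 2" "p 1 \<noteq> p 3" using neq[of 0] neq[of 1] by (auto simp: numeral_eq_Suc)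
  moreover have "{u, v} = {p 0, p 3}" using c(3,4) by (simp add: p_def)
  ultimately show ?thesis using path by (metis doubleton_eq_iff)
qed

text \<open>Forwards, \<open>u\<close> is moved to \<open>D\<^sub>v 3\<close> and the paths of
  length three from there are enumerated. Backwards, transitivity on collinear pairs leaves one
  pair, for which one 9-cycle is exhibited.\<close>

lemma nine_cycle_thirds_iff_coll:
  assumes "u \<in> V" "v \<in> V"
  shows "nine_cycle_thirds u v \<longleftrightarrow> coll u v"
proof
  assume "nine_cycle_thirds u v"
  obtain g h where gh: "symmetry g h" "g (D\<^sub>v 3) = u" using point_orbit[OF assms(1)] by blast
  obtain z where z: "z \<in> V" "g z = v" using symmetry_surj(1)[OF gh(1) assms(2)] by blast
  have inv: "inv_into V g (g x) = x" if "x \<in> V" for x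
    by (rule bij_betw_inv_into_left[OF graph_aut_bij[OF symmetry_aut[OF gh(1)]] that])
  have "nine_cycle_thirds (inv_into V g u) (inv_into V g v)"
    using \<open>nine_cycle_thirds u v\<close>
    by (rule nine_cycle_thirds_map[OF graph_aut_inv[OF symmetry_aut[OF gh(1)]]])
  then have "nine_cycle_thirds (D\<^sub>v 3) z"
    using inv[of "D\<^sub>v 3"] inv[OF z(1)] gh(2) z(2) by simp
  then obtain x y where "x \<in> set (nbs (D\<^sub>v 3))" "y \<in> set (nbs x)" "y \<noteq> D\<^sub>v 3"
    "z \<in> set (nbs y)" "z \<noteq> x" using nine_cycle_thirds_path by blast
  moreover have "\<forall>x\<in>set (nbs (D\<^sub>v 3)). \<forall>y\<in>set (nbs x). y \<noteq> D\<^sub>v 3 \<longrightarrow>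
      (\<forall>z\<in>set (nbs y). z \<noteq> x \<longrightarrow> coll (D\<^sub>v 3) z)"
    by (simp add: coll_iff)
  ultimately have "coll (D\<^sub>v 3) z" by blast
  then show "coll u v" using symmetry_coll[OF gh(1), of "D\<^sub>v 3" z] gh z by simp
next
  assume "coll u v"
  then obtain g h where gh: "symmetry g h" "g (D\<^sub>v 3) = u" "g (F\<^sub>v 12) = v"
    using coll_orbit by blast
  have "nine_cycle_thirds (D\<^sub>v 3) (F\<^sub>v 12)"
    unfolding nine_cycle_thirds_def
  proof (intro exI conjI)
    \<comment> \<open>An explicit 9-cycle through the base pair, which occupies positions 0 and
      3.\<close>
    let ?c = "[D\<^sub>v 3, E\<^sub>v 3, F\<^sub>v 3, F\<^sub>v 12, E\<^sub>v 12, D\<^sub>v 12, D\<^sub>v 14, D\<^sub>v 16, D\<^sub>v 1]"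
    have all_9: "(\<forall>i<9. P i) \<longleftrightarrow>
        P 0 \<and> P 1 \<and> P 2 \<and> P 3 \<and> P 4 \<and> P 5 \<and> P 6 \<and> P 7 \<and> P 8" for P :: "nat \<Rightarrow> bool"
      by (simp add: numeral_eq_Suc All_less_Suc conj_ac)
    have length_9: "length ?c = 9" by simp
    show "graph_cycle biggs_smith ?c"
      unfolding graph_cycle_def length_9 adjacent_biggs_smith all_9 by simp
    show "{D\<^sub>v 3, F\<^sub>v 12} = {?c ! 0, ?c ! ((0 + 3) mod 9)}" by simp
  qed simp_all
  then show "nine_cycle_thirds u v"
    using nine_cycle_thirds_map[OF symmetry_aut[OF gh(1)]] gh(2,3) by blast
qed

lemma verts_Y: "verts \<Y> = V"
  by (simp add: \<Y>_def)

lemma adjacent_Y: "adjacent \<Y> u v \<longleftrightarrow> coll u v"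
proof -
  have "adjacent \<Y> u v \<longleftrightarrow> (\<exists>a b. {u, v} = {a, b} \<and> a \<in> V \<and> b \<in> V \<and> a \<noteq> b \<and> nine_cycle_thirds a b)"
    by (simp add: adjacent_def \<Y>_def nine_cycle_thirds_def)
  also have "\<dots> \<longleftrightarrow> (\<exists>a b. {u, v} = {a, b} \<and> coll a b)"
    using nine_cycle_thirds_iff_coll coll_in_V by (metis coll_def)
  also have "\<dots> \<longleftrightarrow> coll u v"
    by (auto simp: doubleton_eq_iff coll_def)
  finally show ?thesis .
qed

lemma edges_Y: "edges \<Y> = {{u, v} | u v. coll u v}"
proof -
  have "\<exists>u v. e = {u, v}" if "e \<in> edges \<Y>" for e
    using that by (auto simp: \<Y>_def)
  moreover have "{u, v} \<in> edges \<Y> \<longleftrightarrow> coll u v" for u v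
    using adjacent_Y by (simp add: adjacent_def)
  ultimately show ?thesis by blast
qed

lemma symmetry_aut_Y: "symmetry g h \<Longrightarrow> graph_aut g \<Y>"
  using graph_aut_bij[OF symmetry_aut]
  by (simp add: graph_aut_def graph_iso_def verts_Y adjacent_Y symmetry_coll)

section \<open>The configuration\<close>

lemma L_eq_iff: "w \<in> V \<Longrightarrow> w' \<in> V \<Longrightarrow> L w = L w' \<longleftrightarrow> w = w'"
  by (rule inj_on_eq_iff[OF inj_L])

lemma inv_L: "w \<in> V \<Longrightarrow> inv_into V L (L w) = w"
  by (rule inv_into_f_f[OF inj_L])

definition conf :: "bs_vertex config" where
  "conf = Config V (L ` V)"

definition clique :: "bs_vertex \<Rightarrow> bs_vertex graph" where
  "clique w = Graph (L w) {e. e \<subseteq> L w \<and> card e = 2}"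

lemma conf_simps [simp]: "points conf = V" "lines conf = L ` V"
  by (simp_all add: conf_def)

lemma clique_simps [simp]: "verts (clique w) = L w" "edges (clique w) = {e. e \<subseteq> L w \<and> card e = 2}"
  by (simp_all add: clique_def)

lemma edges_Y_eq: "edges \<Y> = (\<Union>w\<in>V. {e. e \<subseteq> L w \<and> card e = 2})"
  unfolding edges_Y coll_def by (auto simp: card_2_iff)

lemma clique_subgraph: "w \<in> V \<Longrightarrow> is_subgraph (clique w) \<Y>"
  by (auto simp: is_subgraph_def simple_graph_def verts_Y edges_Y_eq dest: subsetD[OF line_subset])

lemma clique_K4: "w \<in> V \<Longrightarrow> graph_isomorphic (clique w) (complete_graph 4)"
  by (rule graph_isomorphic_completeI) (auto simp: card_line adjacent_def card_2_iff')

lemma clique_disjoint: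
  assumes "w \<in> V" "w' \<in> V" "w \<noteq> w'"
  shows "edges (clique w) \<inter> edges (clique w') = {}"
proof (rule ccontr)
  assume "edges (clique w) \<inter> edges (clique w') \<noteq> {}"
  then obtain a b where "a \<noteq> b" "{a, b} \<subseteq> L w" "{a, b} \<subseteq> L w'"
    by (auto simp: card_2_iff)
  with assms unique_line show False by blast
qed

lemma inj_clique: "inj_on clique V"
  using inj_L by (auto simp: inj_on_def clique_def)

lemma lines_through_eq: "v \<in> V \<Longrightarrow> {w \<in> V. v \<in> L w} = set (pt_lines v)"
  using in_line_iff pt_lines_subset by blast

lemma card_lines_through: "v \<in> V \<Longrightarrow> card {w \<in> V. v \<in> L w} = 4"
  using distinct_pt_lines distinct_card lines_through_eq by metis

lemma Y_eq_Union: "\<Y> = graph_Union (clique ` V)"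
proof (rule graph.expand, intro conjI)
  show "verts \<Y> = verts (graph_Union (clique ` V))"
    using line_subset line_through by (auto simp: verts_Y graph_Union_def)
  show "edges \<Y> = edges (graph_Union (clique ` V))"
    by (simp add: edges_Y_eq graph_Union_def)
qed

text \<open>Each copy of \<open>K_4\<close> is a line, and an isomorphism between two of them only
  reorders four points, which \<open>line_sorted_orbit\<close> realises.\<close>

lemma Y_K4_UH: "K4_UH \<Y>"
  unfolding K4_UH_def
proof (intro allI impI)
  fix W W' f
  assume W: "graph_isomorphic (induced \<Y> W) (complete_graph 4)"
    and W': "graph_isomorphic (induced \<Y> W') (complete_graph 4)"
    and f: "graph_iso f (induced \<Y> W) (induced \<Y> W')"
  have is_line: "\<exists>w\<in>V. W = L w" if W: "graph_isomorphic (induced \<Y> W) (complete_graph 4)" for W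
  proof -
    have card: "card W = 4" by (rule induced_completeD(1)[OF W])
    have adj: "coll a b" if "a \<in> W" "b \<in> W" "a \<noteq> b" for a b
      using induced_completeD(2)[OF W that] by (simp add: adjacent_Y)
    have "card W > 1" "finite W" using card by (simp_all add: card_ge_0_finite)
    then obtain a b where ab: "a \<in> W" "b \<in> W" "a \<noteq> b"
      by (metis card_le_Suc0_iff_eq linorder_not_le One_nat_def)
    then obtain w where w: "w \<in> V" "a \<in> L w" "b \<in> L w"
      using adj unfolding coll_def by blast
    have "c \<in> L w" if "c \<in> W" for c
      using triangle_in_line[OF adj[OF ab] _ _ w, of c] adj ab w that by metis
    then have "W = L w"
      using card w(1) by (intro card_subset_eq) (auto simp: card_line)
    with w(1) show ?thesis by blast
  qed
  obtain w w' where w: "w \<in> V" "W = L w" "w' \<in> V" "W' = L w'"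
    using is_line W W' by metis
  have "bij_betw f W W'" using f by (simp add: graph_iso_def induced_def)
  then have "distinct (map f (line_pts w))" "set (map f (line_pts w)) = L w'"
    using distinct_line w by (auto simp: distinct_map bij_betw_def)
  \<comment> \<open>\<open>f\<close> turns the listing of \<open>L w\<close> into a listing of
    \<open>L w'\<close>. Both are images of the base listing, so \<open>g'\<close> after the inverse
    of \<open>g\<close> agrees with \<open>f\<close> on \<open>W\<close>.\<close>
  from line_sorted_orbit[OF w(3) this] obtain g' h'
    where g': "symmetry g' h'" "map g' (line_pts (B\<^sub>v 0)) = map f (line_pts w)" by blast
  obtain g h where g: "symmetry g h" "map g (line_pts (B\<^sub>v 0)) = line_pts w"
    using line_sorted_orbit[OF w(1), of "line_pts w"] distinct_line w(1) by blast
  note gY = symmetry_aut_Y[OF g(1)]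
  have "set (line_pts (B\<^sub>v 0)) \<subseteq> verts \<Y>"
    unfolding verts_Y by (rule line_subset) simp
  from graph_aut_inv_map[OF gY this]
  have "map (g' \<circ> inv_into (verts \<Y>) g) (line_pts w) = map f (line_pts w)"
    using g(2) g'(2) by (metis map_map)
  then have "\<forall>v\<in>W. (g' \<circ> inv_into (verts \<Y>) g) v = f v"
    unfolding w(2) by (simp only: map_eq_conv)
  moreover have "graph_aut (g' \<circ> inv_into (verts \<Y>) g) \<Y>"
    by (rule graph_aut_comp[OF graph_aut_inv[OF gY] symmetry_aut_Y[OF g'(1)]])
  ultimately show "\<exists>g. graph_aut g \<Y> \<and> (\<forall>v\<in>W. g v = f v)" by blast
qed

lemma Y_not_line_graph:
  assumes "simple_graph H"
  shows "\<not> graph_isomorphic \<Y> (line_graph H)"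
proof
  assume "graph_isomorphic \<Y> (line_graph H)"
  then obtain f where "graph_iso f \<Y> (line_graph H)" by (auto simp: graph_isomorphic_def)
  \<comment> \<open>An induced claw: three pairwise non-collinear points, on three different lines
    through \<open>D\<^sub>v 3\<close>.\<close>
  from line_graph_claw_free[OF assms this, of "D\<^sub>v 3" "F\<^sub>v 12" "D\<^sub>v 9" "A\<^sub>v 3"]
  show False by (simp add: verts_Y adjacent_Y coll_iff)
qed

lemma conf_n4: "n4_configuration 102 conf"
  unfolding n4_configuration_def
proof (intro conjI ballI impI)
  show "card (lines conf) = 102" by (simp add: card_image inj_L card_V)
  fix p assume p: "p \<in> points conf"
  have "{l \<in> lines conf. p \<in> l} = L ` {w \<in> V. p \<in> L w}" by auto
  moreover have "inj_on L {w \<in> V. p \<in> L w}" using inj_L by (rule inj_on_subset) auto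
  ultimately show "card {l \<in> lines conf. p \<in> l} = 4"
    using p card_lines_through by (simp add: card_image)
  fix q assume "q \<in> points conf" "p \<noteq> q"
  then show "card {l \<in> lines conf. p \<in> l \<and> q \<in> l} \<le> 1"
    using unique_line by (intro card_le_Suc0_iff_eq[THEN iffD2, folded One_nat_def])
      (auto simp: finite_V)
qed (use card_V finite_V card_line line_subset in \<open>auto simp: subset_iff\<close>)

lemma conf_menger: "menger_graph conf = \<Y>"
proof (rule graph.expand, intro conjI)
  show "verts (menger_graph conf) = verts \<Y>" by (simp add: menger_graph_def verts_Y)
  show "edges (menger_graph conf) = edges \<Y>"
  proof -
    have "coll u v \<longleftrightarrow> u \<in> V \<and> v \<in> V \<and> u \<noteq> v \<and> (\<exists>l\<in>L ` V. u \<in> l \<and> v \<in> l)" for u v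
      using line_subset unfolding coll_def by blast
    then show ?thesis by (simp add: menger_graph_def edges_Y)
  qed
qed

section \<open>The duality of the configuration\<close>

definition nu_pt :: "bs_vertex \<Rightarrow> bs_vertex" where
  "nu_pt = affine 6 0"

definition nu_ln :: "bs_vertex \<Rightarrow> bs_vertex" where
  "nu_ln = turn \<circ> affine 6 0"

lemma bij_nu: "bij_betw nu_pt V V" "bij_betw nu_ln V V"
  unfolding nu_pt_def nu_ln_def by (rule bij_affine, rule bij_betw_trans[OF bij_affine(3) bij_turn])

lemma nu_in_V: "v \<in> V \<Longrightarrow> nu_pt v \<in> V" "v \<in> V \<Longrightarrow> nu_ln v \<in> V"
  using bij_nu by (auto dest: bij_betwE)

text \<open>\<open>nu_line\<close> gives one inclusion; four lines pass through \<open>v\<close> and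
  a line has four points, so it is an equality. This upgrades incidence reversal to an
  equivalence.\<close>

lemma nu_ln_image:
  assumes v: "v \<in> V"
  shows "nu_ln ` {w \<in> V. v \<in> L w} = L (nu_pt v)"
proof (rule card_subset_eq)
  show "nu_ln ` {w \<in> V. v \<in> L w} \<subseteq> L (nu_pt v)"
    using nu_line by (auto simp: nu_pt_def nu_ln_def)
  have "inj_on nu_ln {w \<in> V. v \<in> L w}"
    using bij_nu(2) by (auto simp: bij_betw_def inj_on_def)
  then show "card (nu_ln ` {w \<in> V. v \<in> L w}) = card (L (nu_pt v))"
    using v by (simp add: card_image card_lines_through card_line nu_in_V)
qed simp

lemma nu_in_line_iff:
  assumes "v \<in> V" "w \<in> V"
  shows "nu_ln w \<in> L (nu_pt v) \<longleftrightarrow> v \<in> L w"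
  using assms bij_nu(2) unfolding nu_ln_image[OF assms(1), symmetric]
  by (auto simp: bij_betw_def inj_on_eq_iff)

lemma conf_self_dual: "self_dual conf"
  unfolding self_dual_def
proof
  have "bij_betw (L \<circ> nu_pt) V (L ` V)"
    by (rule bij_betw_trans[OF bij_nu(1)]) (simp add: inj_L inj_on_imp_bij_betw)
  \<comment> \<open>The points of \<open>L w\<close> go to the lines through the point
    \<open>nu_ln w\<close>, that is, to a line of the dual.\<close>
  moreover have "(L \<circ> nu_pt) ` L w = {l \<in> L ` V. nu_ln w \<in> l}" if w: "w \<in> V" for w
  proof -
    have "{l \<in> L ` V. nu_ln w \<in> l} = L ` {u \<in> nu_pt ` V. nu_ln w \<in> L u}"
      using bij_nu(1) by (auto simp: bij_betw_def)
    also have "{u \<in> nu_pt ` V. nu_ln w \<in> L u} = nu_pt ` L w"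
      using nu_in_line_iff[OF _ w] line_subset[OF w] by auto
    finally show ?thesis by (simp add: image_comp)
  qed
  then have "(\<lambda>w. (L \<circ> nu_pt) ` L w) ` V = (\<lambda>p. {l \<in> L ` V. p \<in> l}) ` nu_ln ` V"
    by (auto simp: image_iff)
  then have "(\<lambda>l. (L \<circ> nu_pt) ` l) ` L ` V = (\<lambda>p. {l \<in> L ` V. p \<in> l}) ` V"
    using bij_betw_imp_surj_on[OF bij_nu(2)] by (simp only: image_image)
  ultimately show "config_iso (L \<circ> nu_pt) conf (dual_config conf)"
    by (simp add: config_iso_def dual_config_def)
qed

section \<open>Transitivity and distances in the Menger graph\<close>

lemma Y_arc_transitive: "arc_transitive \<Y>"
  unfolding arc_transitive_def
proof (rule s_arc_transitiveI[of "[D\<^sub>v 3, F\<^sub>v 12]"])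
  fix p assume p: "s_arc \<Y> 1 p"
  then obtain u v where uv: "p = [u, v]"
    by (auto simp: s_arc_def length_Suc_conv)
  with p have "coll u v" by (simp add: s_arc_def adjacent_Y)
  then show "\<exists>g. graph_aut g \<Y> \<and> map g [D\<^sub>v 3, F\<^sub>v 12] = p"
    using coll_orbit symmetry_aut_Y uv by fastforce
qed (simp add: verts_Y)

lemma Y_vertex_transitive: "vertex_transitive \<Y>"
proof (rule vertex_transitiveI[of "D\<^sub>v 3"])
  show "\<exists>g. graph_aut g \<Y> \<and> g (D\<^sub>v 3) = v" if "v \<in> verts \<Y>" for v
    using point_orbit[of v] symmetry_aut_Y that unfolding verts_Y by blast
qed (simp add: verts_Y)

text \<open>Four lines pass through a point, each with three further points, and by
  \<open>unique_line\<close> these triples are disjoint.\<close>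

lemma Y_regular: "regular_graph 12 \<Y>"
  unfolding regular_graph_def
proof
  fix v assume v: "v \<in> verts \<Y>"
  have "{u \<in> verts \<Y>. adjacent \<Y> v u} = (\<Union>w\<in>{w \<in> V. v \<in> L w}. L w - {v})"
    using line_subset unfolding adjacent_Y verts_Y coll_def by blast
  also have "card \<dots> = (\<Sum>w\<in>{w \<in> V. v \<in> L w}. card (L w - {v}))"
    using unique_line by (intro card_UN_disjoint) (auto simp: finite_V)
  also have "\<dots> = (\<Sum>w\<in>{w \<in> V. v \<in> L w}. 3)"
    by (intro sum.cong refl) (simp add: card_line card_Diff_singleton)
  also have "\<dots> = 12" using v card_lines_through by (simp add: verts_Y)
  finally show "card {u \<in> verts \<Y>. adjacent \<Y> v u} = 12" .
qed

lemma lev_pt_eq_0_iff: "v \<in> V \<Longrightarrow> lev_pt v = 0 \<longleftrightarrow> v = D\<^sub>v 3"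
  using lev_pt_pred by (metis Zero_not_Suc)

text \<open>Collinear points are two steps apart in the Levi graph, so halving the Levi levels of
  the points gives their distances in \<open>\<Y>\<close>.\<close>

interpretation Y: distance_levels \<Y> "D\<^sub>v 3" "\<lambda>v. lev_pt v div 2"
proof
  show "D\<^sub>v 3 \<in> verts \<Y>" by (simp add: verts_Y)
  show "lev_pt (D\<^sub>v 3) div 2 = 0" by simp
next
  fix v assume "v \<in> verts \<Y>" "lev_pt v div 2 = 0"
  then show "v = D\<^sub>v 3"
    using lev_pt_even lev_pt_eq_0_iff unfolding verts_Y by (metis dvd_div_eq_0_iff)
next
  fix u v assume "adjacent \<Y> u v"
  then obtain w where "w \<in> V" "u \<in> L w" "v \<in> L w" by (auto simp: adjacent_Y coll_def)
  with lev_flag have "lev_pt v \<le> lev_pt u + 2"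
    by (metis add_2_eq_Suc' le_SucI le_refl Suc_n_not_le_n nat_le_linear)
  then show "lev_pt v div 2 \<le> Suc (lev_pt u div 2)" by linarith
next
  fix v assume v: "v \<in> verts \<Y>" "lev_pt v div 2 \<noteq> 0"
  then have "v \<noteq> D\<^sub>v 3" "v \<in> V" by (auto simp: verts_Y)
  then obtain w where w: "w \<in> V" "v \<in> L w" "lev_pt v = Suc (lev_ln w)"
    using lev_pt_pred in_line_iff pt_lines_subset by (metis subsetD)
  obtain u where u: "u \<in> L w" "lev_ln w = Suc (lev_pt u)"
    using lev_ln_pred w(1) by blast
  with w have "lev_pt v = lev_pt u + 2" "coll u v" by (auto simp: coll_def)
  then show "\<exists>u\<in>verts \<Y>. adjacent \<Y> u v \<and> lev_pt v div 2 = Suc (lev_pt u div 2)"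
    using coll_in_V by (intro bexI[of _ u]) (auto simp: adjacent_Y verts_Y)
qed

lemma Y_distribution: "has_distance_distribution \<Y> [1, 12, 78, 11]"
  unfolding has_distance_distribution_def
proof (intro conjI ballI allI)
  show "vertex_transitive \<Y>" by (rule Y_vertex_transitive)
  fix v k assume "v \<in> verts \<Y>"
  then have "card {u \<in> verts \<Y>. graph_dist \<Y> v u = enat k} = card {u \<in> V. lev_pt u div 2 = k}"
    using Y.card_at_distance[OF Y_vertex_transitive] by (simp add: verts_Y)
  \<comment> \<open>Points have even level, so halving loses nothing.\<close>
  also have "{u \<in> V. lev_pt u div 2 = k} = {u \<in> V. lev_pt u = 2 * k}"
    using lev_pt_even by auto
  also have "card \<dots> = (if k < length [1, 12, 78, 11] then [1, 12, 78, 11] ! k else 0)"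
  proof -
    consider "k = 0" | "k = 1" | "k = 2" | "k = 3" | "k \<ge> 4" by linarith
    then show ?thesis
    proof cases
      case 5
      then have "{u \<in> V. lev_pt u = 2 * k} = {}" using lev_pt_even by fastforce
      with 5 show ?thesis by (simp only: card.empty) simp
    qed (simp_all add: card_lev_pt)
  qed
  finally show "card {u \<in> verts \<Y>. graph_dist \<Y> v u = enat k} =
    (if k < length [1, 12, 78, 11] then [1, 12, 78, 11] ! k else 0)" .
qed

lemma ex_lev_pt_6: "\<exists>v\<in>V. lev_pt v = 6"
proof -
  have "{v \<in> V. lev_pt v = 6} \<noteq> {}"
    using card_lev_pt(4) by (metis card.empty zero_neq_numeral)
  then show ?thesis by blast
qed

lemma Y_diameter: "graph_diameter \<Y> = 3"
proof -
  obtain v where "v \<in> V" "lev_pt v = 6" using ex_lev_pt_6 by blast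
  then have "graph_diameter \<Y> = enat 3"
    using lev_pt_even by (intro Y.diameter_eq[OF Y_vertex_transitive]) (fastforce simp: verts_Y)+
  then show ?thesis by (simp add: numeral_eq_enat)
qed

section \<open>The Levi graph\<close>

abbreviation \<Lambda> :: "(bs_vertex + bs_vertex set) graph" where
  "\<Lambda> \<equiv> levi_graph conf"

lemma verts_Levi: "verts \<Lambda> = V <+> L ` V"
  by (simp add: levi_graph_def)

lemma adjacent_Levi [simp]:
  "adjacent \<Lambda> (Inl p) (Inr l) \<longleftrightarrow> p \<in> V \<and> l \<in> L ` V \<and> p \<in> l"
  "adjacent \<Lambda> (Inr l) (Inl p) \<longleftrightarrow> p \<in> V \<and> l \<in> L ` V \<and> p \<in> l"
  "\<not> adjacent \<Lambda> (Inl p) (Inl q)" "\<not> adjacent \<Lambda> (Inr l) (Inr m)"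
  by (auto simp: adjacent_def levi_graph_def doubleton_eq_iff)

lemma Levi_vertex_cases [consumes 1, case_names point line]:
  assumes "x \<in> verts \<Lambda>"
  obtains p where "x = Inl p" "p \<in> V" | w where "x = Inr (L w)" "w \<in> V"
  using assms by (auto simp: verts_Levi)

lemma symmetry_Levi:
  assumes gh: "symmetry g h"
  shows "graph_aut (map_sum g (image g)) \<Lambda>"
proof -
  let ?f = "map_sum g (image g)"
  have image_line: "g ` L w = L (h w)" if "w \<in> V" for w
    using symmetry_line[OF gh that] by simp
  have h: "bij_betw h V V" using gh by (simp add: symmetry_def)
  then have h_eq: "h w = h w' \<longleftrightarrow> w = w'" if "w \<in> V" "w' \<in> V" for w w'
    using that by (rule inj_on_eq_iff[OF bij_betw_imp_inj_on])
  have "inj_on ?f (verts \<Lambda>)"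
  proof (rule inj_onI)
    fix x y assume "x \<in> verts \<Lambda>" "y \<in> verts \<Lambda>" "?f x = ?f y"
    then show "x = y"
      by (elim Levi_vertex_cases)
        (auto simp: image_line L_eq_iff h_eq symmetry_in_V[OF gh] symmetry_inj[OF gh])
  qed
  moreover have "?f ` verts \<Lambda> = verts \<Lambda>"
  proof
    show "?f ` verts \<Lambda> \<subseteq> verts \<Lambda>"
      by (auto simp: verts_Levi image_line symmetry_in_V[OF gh])
    show "verts \<Lambda> \<subseteq> ?f ` verts \<Lambda>"
    proof
      fix x assume "x \<in> verts \<Lambda>"
      then show "x \<in> ?f ` verts \<Lambda>"
      proof (cases rule: Levi_vertex_cases)
        case (point p)
        then obtain u where "u \<in> V" "g u = p" using symmetry_surj(1)[OF gh] by blast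
        with point show ?thesis by (intro image_eqI[of _ _ "Inl u"]) (auto simp: verts_Levi)
      next
        case (line w)
        then obtain u where "u \<in> V" "h u = w" using symmetry_surj(2)[OF gh] by blast
        with line image_line show ?thesis
          by (intro image_eqI[of _ _ "Inr (L u)"]) (auto simp: verts_Levi)
      qed
    qed
  qed
  moreover have "adjacent \<Lambda> x y \<longleftrightarrow> adjacent \<Lambda> (?f x) (?f y)"
    if "x \<in> verts \<Lambda>" "y \<in> verts \<Lambda>" for x y
    using that
    by (elim Levi_vertex_cases)
      (auto simp: image_line symmetry_in_V[OF gh] symmetry_in_line_iff[OF gh])
  ultimately show ?thesis by (simp add: graph_aut_def graph_iso_def bij_betw_def)
qed

text \<open>Lines are point sets here while \<open>nu_ln\<close> acts on labels;
  \<open>inv_into V L\<close> recovers the label.\<close>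

fun duality :: "bs_vertex + bs_vertex set \<Rightarrow> bs_vertex + bs_vertex set" where
  "duality (Inl p) = Inr (L (nu_pt p))" |
  "duality (Inr l) = Inl (nu_ln (inv_into V L l))"

lemma duality_aut: "graph_aut duality \<Lambda>"
proof -
  have nu_eq: "nu_pt v = nu_pt w \<longleftrightarrow> v = w" "nu_ln v = nu_ln w \<longleftrightarrow> v = w" if "v \<in> V" "w \<in> V" for v w
    using that bij_nu[THEN bij_betw_imp_inj_on] by (simp_all only: inj_on_eq_iff)
  have "inj_on duality (verts \<Lambda>)"
  proof (rule inj_onI)
    fix x y assume "x \<in> verts \<Lambda>" "y \<in> verts \<Lambda>" "duality x = duality y"
    then show "x = y"
      by (elim Levi_vertex_cases) (auto simp: inv_L L_eq_iff nu_eq nu_in_V)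
  qed
  moreover have "duality ` verts \<Lambda> = verts \<Lambda>"
  proof
    show "duality ` verts \<Lambda> \<subseteq> verts \<Lambda>"
      by (auto simp: verts_Levi inv_L nu_in_V)
    show "verts \<Lambda> \<subseteq> duality ` verts \<Lambda>"
    proof
      fix x assume "x \<in> verts \<Lambda>"
      then show "x \<in> duality ` verts \<Lambda>"
      proof (cases rule: Levi_vertex_cases)
        case (point p)
        then obtain u where "u \<in> V" "nu_ln u = p"
          using bij_nu(2) by (metis bij_betw_imp_surj_on imageE)
        with point show ?thesis by (intro image_eqI[of _ _ "Inr (L u)"]) (auto simp: verts_Levi inv_L)
      next
        case (line w)
        then obtain u where "u \<in> V" "nu_pt u = w"
          using bij_nu(1) by (metis bij_betw_imp_surj_on imageE)
        with line show ?thesis by (intro image_eqI[of _ _ "Inl u"]) (auto simp: verts_Levi)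
      qed
    qed
  qed
  moreover have "adjacent \<Lambda> x y \<longleftrightarrow> adjacent \<Lambda> (duality x) (duality y)"
    if "x \<in> verts \<Lambda>" "y \<in> verts \<Lambda>" for x y
    using that
    by (elim Levi_vertex_cases) (auto simp: inv_L nu_in_V nu_in_line_iff)
  ultimately show ?thesis by (simp add: graph_aut_def graph_iso_def bij_betw_def)
qed

text \<open>A 2-arc centred at a line is an ordered pair of points on it, which
  \<open>arc_orbit\<close> handles; the duality reduces those centred at a point to this
  case.\<close>

lemma Levi_2_arc_transitive: "s_arc_transitive 2 \<Lambda>"
proof (rule s_arc_transitiveI)
  let ?b = "[Inl (D\<^sub>v 3), Inr (L (B\<^sub>v 0)), Inl (F\<^sub>v 12)]"
  have "B\<^sub>v 0 \<in> V" by simp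
  then have "Inr (L (B\<^sub>v 0)) \<in> verts \<Lambda>"
    unfolding verts_Levi by (intro InrI imageI)
  moreover have "Inl (D\<^sub>v 3) \<in> verts \<Lambda>" "Inl (F\<^sub>v 12) \<in> verts \<Lambda>"
    by (auto simp: verts_Levi)
  ultimately show "set ?b \<subseteq> verts \<Lambda>"
    by (simp only: list.set insert_subset empty_subsetI simp_thms)
  have line_centred: "\<exists>f. graph_aut f \<Lambda> \<and> map f ?b = p" if p: "s_arc \<Lambda> 2 p" "p ! 1 = Inr l" for p l
  proof -
    obtain x y z where xyz: "p = [x, y, z]"
      using p(1) by (auto simp: s_arc_def length_Suc_conv eval_nat_numeral)
    have y: "y = Inr l" using p(2) xyz by simp
    have "adjacent \<Lambda> x y" "adjacent \<Lambda> y z" "x \<noteq> z"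
      using p(1) unfolding s_arc_def xyz by (auto simp: eval_nat_numeral All_less_Suc)
    with y obtain a w b where w: "x = Inl a" "z = Inl b" "l = L w"
      "w \<in> V" "a \<in> L w" "b \<in> L w" "a \<noteq> b"
      by (cases x; cases z) auto
    obtain g h where gh: "symmetry g h" "h (B\<^sub>v 0) = w" "g (D\<^sub>v 3) = a" "g (F\<^sub>v 12) = b"
      using arc_orbit[OF w(4-7)] by blast
    have "g ` L (B\<^sub>v 0) = L w" using symmetry_line[OF gh(1) \<open>B\<^sub>v 0 \<in> V\<close>] gh(2) by simp
    then have "map (map_sum g (image g)) ?b = p"
      unfolding xyz y w(1-3) list.map map_sum.simps gh by simp
    with symmetry_Levi[OF gh(1)] show ?thesis by blast
  qed
  fix p assume p: "s_arc \<Lambda> 2 p"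
  show "\<exists>f. graph_aut f \<Lambda> \<and> map f ?b = p"
  proof (cases "p ! 1")
    case (Inr l)
    with line_centred[OF p] show ?thesis by blast
  next
    case (Inl v)
    \<comment> \<open>The inverse of the duality makes the centre a line; the automorphism found
      there is then followed by \<open>duality\<close>.\<close>
    let ?i = "inv_into (verts \<Lambda>) duality"
    have sub: "set p \<subseteq> verts \<Lambda>" and len: "length p = 3" using p by (auto simp: s_arc_def)
    have surj: "duality (?i x) = x" if "x \<in> verts \<Lambda>" for x
      using bij_betw_inv_into_right[OF graph_aut_bij[OF duality_aut] that] .
    have "p ! 1 \<in> verts \<Lambda>" using sub len by (simp add: subset_iff)
    then have "duality (?i (p ! 1)) = Inl v" using surj Inl by metis
    then obtain l where "?i (p ! 1) = Inr l" by (cases "?i (p ! 1)") auto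
    then have "map ?i p ! 1 = Inr l" using len by simp
    with line_centred[OF s_arc_map[OF graph_aut_inv[OF duality_aut] p]]
    obtain f where f: "graph_aut f \<Lambda>" "map f ?b = map ?i p" by blast
    have "map duality (map ?i p) = p"
      using sub surj by (induction p) auto
    then have "map (duality \<circ> f) ?b = p" using f(2) by (metis map_map)
    with graph_aut_comp[OF f(1) duality_aut] show ?thesis by blast
  qed
qed

text \<open>Symmetries reach all points, and one further application of \<open>duality\<close>
  reaches all lines.\<close>

lemma Levi_vertex_transitive: "vertex_transitive \<Lambda>"
proof (rule vertex_transitiveI[of "Inl (D\<^sub>v 3)"])
  show "Inl (D\<^sub>v 3) \<in> verts \<Lambda>" by (auto simp: verts_Levi)
  have point_image: "\<exists>f. graph_aut f \<Lambda> \<and> f (Inl (D\<^sub>v 3)) = Inl p" if "p \<in> V" for p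
    using point_orbit[OF that] symmetry_Levi by fastforce
  fix x assume "x \<in> verts \<Lambda>"
  then show "\<exists>f. graph_aut f \<Lambda> \<and> f (Inl (D\<^sub>v 3)) = x"
  proof (cases rule: Levi_vertex_cases)
    case (point p)
    then show ?thesis using point_image by blast
  next
    case (line w)
    then obtain p where p: "p \<in> V" "nu_pt p = w"
      using bij_nu(1) by (metis bij_betw_imp_surj_on imageE)
    obtain f where f: "graph_aut f \<Lambda>" "f (Inl (D\<^sub>v 3)) = Inl p" using point_image[OF p(1)] by blast
    then have "(duality \<circ> f) (Inl (D\<^sub>v 3)) = x" using line p by simp
    then show ?thesis using graph_aut_comp[OF f(1) duality_aut] by blast
  qed
qed

lemma Levi_regular: "regular_graph 4 \<Lambda>"
  unfolding regular_graph_def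
proof
  fix x assume "x \<in> verts \<Lambda>"
  then show "card {y \<in> verts \<Lambda>. adjacent \<Lambda> x y} = 4"
  proof (cases rule: Levi_vertex_cases)
    case (point p)
    then have "{y \<in> verts \<Lambda>. adjacent \<Lambda> x y} = (Inr \<circ> L) ` {w \<in> V. p \<in> L w}"
      by (auto simp: verts_Levi)
    moreover have "inj_on (Inr \<circ> L :: _ \<Rightarrow> bs_vertex + _) {w \<in> V. p \<in> L w}"
      using inj_L by (auto simp: inj_on_def)
    ultimately show ?thesis using point card_lines_through[of p] by (simp only: card_image)
  next
    case (line w)
    then have "{y \<in> verts \<Lambda>. adjacent \<Lambda> x y} = Inl ` L w"
      using line_subset[of w] by (auto simp: verts_Levi)
    then show ?thesis using line by (simp add: card_image card_line)
  qed
qed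

section \<open>Distances in the Levi graph\<close>

fun lev :: "bs_vertex + bs_vertex set \<Rightarrow> nat" where
  "lev (Inl p) = lev_pt p" |
  "lev (Inr l) = lev_ln (inv_into V L l)"

lemma lev_line: "w \<in> V \<Longrightarrow> lev (Inr (L w)) = lev_ln w"
  by (simp add: inv_L)

interpretation Levi: distance_levels \<Lambda> "Inl (D\<^sub>v 3)" lev
proof
  show "Inl (D\<^sub>v 3) \<in> verts \<Lambda>" by (auto simp: verts_Levi)
  show "lev (Inl (D\<^sub>v 3)) = 0" by simp
next
  fix x assume "x \<in> verts \<Lambda>" "lev x = 0"
  then show "x = Inl (D\<^sub>v 3)"
    using lev_pt_eq_0_iff lev_ln_odd
    by (elim Levi_vertex_cases) (auto simp: lev_line simp del: lev.simps(2) lev_ln.simps)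
next
  fix x y assume "x \<in> verts \<Lambda>" "y \<in> verts \<Lambda>" "adjacent \<Lambda> x y"
  then show "lev y \<le> Suc (lev x)"
  proof (elim Levi_vertex_cases)
    fix p w assume "x = Inl p" "p \<in> V" "y = Inr (L w)" "w \<in> V"
    with \<open>adjacent \<Lambda> x y\<close> lev_flag show ?thesis by (fastforce simp: lev_line simp del: lev.simps(2))
  next
    fix p w assume "y = Inl p" "p \<in> V" "x = Inr (L w)" "w \<in> V"
    with \<open>adjacent \<Lambda> x y\<close> lev_flag show ?thesis by (fastforce simp: lev_line simp del: lev.simps(2))
  qed simp_all
next
  fix x assume "x \<in> verts \<Lambda>" "lev x \<noteq> 0"
  then show "\<exists>y\<in>verts \<Lambda>. adjacent \<Lambda> y x \<and> lev x = Suc (lev y)"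
  proof (cases rule: Levi_vertex_cases)
    case (point p)
    with \<open>lev x \<noteq> 0\<close> have "p \<noteq> D\<^sub>v 3" by auto
    with point obtain w where "w \<in> V" "p \<in> L w" "lev_pt p = Suc (lev_ln w)"
      using lev_pt_pred in_line_iff pt_lines_subset by (metis subsetD)
    with point show ?thesis
      by (intro bexI[of _ "Inr (L w)"]) (auto simp: lev_line verts_Levi simp del: lev.simps(2))
  next
    case (line w)
    then obtain p where "p \<in> L w" "lev_ln w = Suc (lev_pt p)" using lev_ln_pred by blast
    with line line_subset show ?thesis
      by (intro bexI[of _ "Inl p"]) (auto simp: lev_line verts_Levi simp del: lev.simps(2))
  qed
qed

text \<open>The graph is bipartite: even levels contain only points and odd levels only lines, so
  each level is counted in one table.\<close>

lemma card_lev: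
  "card {x \<in> verts \<Lambda>. lev x = k} =
    (if even k then card {v \<in> V. lev_pt v = k} else card {w \<in> V. lev_ln w = k})"
proof -
  have "{x \<in> verts \<Lambda>. lev x = k} = {v \<in> V. lev_pt v = k} <+> L ` {w \<in> V. lev_ln w = k}"
    by (auto simp: verts_Levi lev_line simp del: lev.simps(2))
  moreover have "inj_on L {w \<in> V. lev_ln w = k}" using inj_L by (rule inj_on_subset) auto
  moreover have "{v \<in> V. lev_pt v = k} = {}" if "odd k" using lev_pt_even that by auto
  moreover have "{w \<in> V. lev_ln w = k} = {}" if "even k" using lev_ln_odd that by auto
  ultimately show ?thesis by (cases "even k") (simp_all add: card_Plus finite_V card_image)
qed

lemma lev_le_6: "x \<in> verts \<Lambda> \<Longrightarrow> lev x \<le> 6"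
  using lev_pt_even lev_ln_odd
  by (elim Levi_vertex_cases) (fastforce simp: lev_line simp del: lev.simps(2))+

lemma Levi_distribution: "has_distance_distribution \<Lambda> [1, 4, 12, 36, 78, 62, 11]"
  unfolding has_distance_distribution_def
proof (intro conjI ballI allI)
  show "vertex_transitive \<Lambda>" by (rule Levi_vertex_transitive)
  fix x k assume "x \<in> verts \<Lambda>"
  then have "card {y \<in> verts \<Lambda>. graph_dist \<Lambda> x y = enat k} = card {y \<in> verts \<Lambda>. lev y = k}"
    by (rule Levi.card_at_distance[OF Levi_vertex_transitive])
  also have "\<dots> = (if k < length [1, 4, 12, 36, 78, 62, 11] then [1, 4, 12, 36, 78, 62, 11] ! k else 0)"
  proof -
    consider "k = 0" | "k = 1" | "k = 2" | "k = 3" | "k = 4" | "k = 5" | "k = 6" | "k \<ge> 7" by linarith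
    then show ?thesis
    proof cases
      case 8
      then have "{y \<in> verts \<Lambda>. lev y = k} = {}" using lev_le_6 by fastforce
      then have "card {y \<in> verts \<Lambda>. lev y = k} = 0" by (simp only: card.empty)
      with 8 show ?thesis by simp
    qed (simp_all add: card_lev card_lev_pt card_lev_ln[simplified])
  qed
  finally show "card {y \<in> verts \<Lambda>. graph_dist \<Lambda> x y = enat k} =
    (if k < length [1, 4, 12, 36, 78, 62, 11] then [1, 4, 12, 36, 78, 62, 11] ! k else 0)" .
qed

lemma Levi_diameter: "graph_diameter \<Lambda> = 6"
proof -
  obtain v where "v \<in> V" "lev_pt v = 6" using ex_lev_pt_6 by blast
  then have "graph_diameter \<Lambda> = enat 6"
    by (intro Levi.diameter_eq[OF Levi_vertex_transitive lev_le_6, of "Inl v"])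
      (auto simp: verts_Levi)
  then show ?thesis by (simp add: numeral_eq_enat)
qed

theorem theorem4:
  shows "\<exists>\<K> :: bs_vertex graph set.
     card \<K> = 102 \<and>
     (\<forall>H \<in> \<K>. is_subgraph H \<Y> \<and> graph_isomorphic H (complete_graph 4)) \<and>
     (\<forall>H \<in> \<K>. \<forall>H' \<in> \<K>. H \<noteq> H' \<longrightarrow> edges H \<inter> edges H' = {}) \<and>
     \<Y> = graph_Union \<K> \<and>
     (\<forall>v \<in> verts \<Y>. card {H \<in> \<K>. v \<in> verts H} = 4) \<and>
     (\<forall>H :: 'b graph. simple_graph H \<longrightarrow> \<not> graph_isomorphic \<Y> (line_graph H)) \<and>
     K4_UH \<Y> \<and>
     (let C = Config (verts \<Y>) (verts ` \<K>) in
        n4_configuration 102 C \<and> self_dual C \<and> menger_graph C = \<Y> \<and>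
        arc_transitive \<Y> \<and> regular_graph 12 \<Y> \<and> graph_diameter \<Y> = 3 \<and>
        has_distance_distribution \<Y> [1, 12, 78, 11] \<and>
        s_arc_transitive 2 (levi_graph C) \<and> regular_graph 4 (levi_graph C) \<and>
        graph_diameter (levi_graph C) = 6 \<and>
        has_distance_distribution (levi_graph C) [1, 4, 12, 36, 78, 62, 11])"
proof (intro exI[of _ "clique ` V"] conjI)
  show "card (clique ` V) = 102" by (simp add: card_image inj_clique card_V)
  show "\<forall>H\<in>clique ` V. is_subgraph H \<Y> \<and> graph_isomorphic H (complete_graph 4)"
    using clique_subgraph clique_K4 by blast
  show "\<forall>H\<in>clique ` V. \<forall>H'\<in>clique ` V. H \<noteq> H' \<longrightarrow> edges H \<inter> edges H' = {}"
    using clique_disjoint by blast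
  show "\<forall>v\<in>verts \<Y>. card {H \<in> clique ` V. v \<in> verts H} = 4"
  proof
    fix v assume v: "v \<in> verts \<Y>"
    have "{H \<in> clique ` V. v \<in> verts H} = clique ` {w \<in> V. v \<in> L w}" by auto
    moreover have "inj_on clique {w \<in> V. v \<in> L w}" using inj_clique by (rule inj_on_subset) auto
    ultimately show "card {H \<in> clique ` V. v \<in> verts H} = 4"
      using v by (simp add: verts_Y card_image card_lines_through)
  qed
  \<comment> \<open>The vertex sets of the cliques are the lines, so the configuration of the
    statement is \<open>conf\<close>.\<close>
  have conf_eq: "Config (verts \<Y>) (verts ` clique ` V) = conf"
    by (simp add: conf_def verts_Y image_image)
  show "let C = Config (verts \<Y>) (verts ` clique ` V) in
        n4_configuration 102 C \<and> self_dual C \<and> menger_graph C = \<Y> \<and>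
        arc_transitive \<Y> \<and> regular_graph 12 \<Y> \<and> graph_diameter \<Y> = 3 \<and>
        has_distance_distribution \<Y> [1, 12, 78, 11] \<and>
        s_arc_transitive 2 (levi_graph C) \<and> regular_graph 4 (levi_graph C) \<and>
        graph_diameter (levi_graph C) = 6 \<and>
        has_distance_distribution (levi_graph C) [1, 4, 12, 36, 78, 62, 11]"
    unfolding Let_def conf_eq
    by (intro conjI conf_n4 conf_self_dual conf_menger Y_arc_transitive Y_regular Y_diameter
        Y_distribution Levi_2_arc_transitive Levi_regular Levi_diameter Levi_distribution)
qed (use Y_eq_Union Y_not_line_graph Y_K4_UH in blast)+

end
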